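(* Let $R$ be a commutative ring and $\mathcal{D}$ an $R$-linear triangulated category. Let $M:\mathcal{D}\to\mathrm{Mod}\text{-}R$ be a cohomological functor, and let $\mathcal{A}\subseteq\mathcal{D}$ be a full subcategory such that $\mathcal{A}[1]=\mathcal{A}$, $\mathcal{A}$ is precovering in $\mathcal{D}$, and $\mathcal{A}^{*n}=\mathcal{D}$ for some $n\geq 1$. Suppose that $M$ is $\mathcal{A}$-finitely generated and that, for any $D\in\mathcal{D}$, the kernel of every natural transformation $\mathcal{D}(-,D)\to M$ is also $\mathcal{A}$-finitely generated. Then $M$ is isomorphic to a direct summand of a representable functor $\mathcal{D}(-,X)$, $X\in\mathcal{D}$. In particular, if $\mathcal{D}$ is karoubian, then $M$ is representable.
   Context: All functors are $R$-linear and all subcategories are full. A cohomological functor $M:\mathcal{D}\to\mathrm{Mod}\text{-}R$ is a contravariant functor sending each triangle $X\to Y\to Z\to X[1]$ to an exact sequence $M(Z)\to M(Y)\to M(X)$. A contravariant functor $N:\mathcal{D}\to\mathrm{Mod}\text{-}R$ is $\mathcal{A}$-finitely generated if there are $A\in\mathcal{A}$ and a natural transformation $\alpha:\mathcal{D}(-,A)\to N$ such that $\alpha^X:\mathcal{D}(X,A)\to N(X)$ is surjective for all $X\in\mathcal{A}$. The subcategory $\mathcal{A}$ is precovering if for every $D\in\mathcal{D}$ there is a morphism $A\to D$ with $A\in\mathcal{A}$ such that $\mathcal{D}(X,A)\to\mathcal{D}(X,D)$ is surjective for all $X\in\mathcal{A}$. For subcategories $\mathcal{A},\mathcal{B}\subseteq\mathcal{D}$,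 $\mathrm{smd}\,\mathcal{A}$ is the closure of $\mathcal{A}$ under direct summands and $\mathcal{A}*\mathcal{B}$ is the class of $Y\in\mathcal{D}$ for which there is a triangle $X\to Y\to Z\to X[1]$ with $X\in\mathcal{A}$, $Z\in\mathcal{B}$. Put $\mathcal{A}^{*1}=\mathrm{smd}\,\mathcal{A}$ and $\mathcal{A}^{*(n+1)}=\mathrm{smd}(\mathcal{A}^{*n}*\mathcal{A}^{*1})$ for $n\ge 1$. A category is karoubian if every idempotent endomorphism in it splits. *)

theory Defs
  imports "HOL-Algebra.Module"
begin

text \<open>
  A category has a set of objects and, for each pair of objects, a hom-set that carries the
  structure of an \<open>R\<close>-module (the ring multiplication fields of the record \<^type>\<open>module\<close> are not
  used).  Hom-sets are pairwise disjoint, so that composition, and the action of functors on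
  morphisms, need not be indexed by objects.
\<close>

record ('r, 'o, 'm) lin_cat =
  Obj :: "'o set"
  Hom :: "'o \<Rightarrow> 'o \<Rightarrow> ('r, 'm) module"
  Id :: "'o \<Rightarrow> 'm"
  Comp :: "'m \<Rightarrow> 'm \<Rightarrow> 'm"  (infixr \<open>\<cdot>\<index>\<close> 75)

abbreviation homs :: "('r, 'o, 'm, 'c) lin_cat_scheme \<Rightarrow> 'o \<Rightarrow> 'o \<Rightarrow> 'm set"
  where "homs C X Y \<equiv> carrier (Hom C X Y)"

definition mod_hom ::
    "('r, 'k) ring_scheme \<Rightarrow> ('r, 'a) module \<Rightarrow> ('r, 'b) module \<Rightarrow> ('a \<Rightarrow> 'b) set"
  where "mod_hom R M N =
    {\<phi>. (\<forall>x \<in> carrier M. \<phi> x \<in> carrier N) \<and>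
        (\<forall>x \<in> carrier M. \<forall>y \<in> carrier M. \<phi> (x \<oplus>\<^bsub>M\<^esub> y) = \<phi> x \<oplus>\<^bsub>N\<^esub> \<phi> y) \<and>
        (\<forall>r \<in> carrier R. \<forall>x \<in> carrier M. \<phi> (r \<odot>\<^bsub>M\<^esub> x) = r \<odot>\<^bsub>N\<^esub> \<phi> x)}"

locale linear_category =
  fixes R :: "('r, 'k) ring_scheme"
    and C :: "('r, 'o, 'm, 'c) lin_cat_scheme" (structure)
  assumes base_cring: "cring R"
    and Hom_module: "\<lbrakk>X \<in> Obj C; Y \<in> Obj C\<rbrakk> \<Longrightarrow> module R (Hom C X Y)"
    and Hom_disjoint:
      "\<lbrakk>X \<in> Obj C; Y \<in> Obj C; X' \<in> Obj C; Y' \<in> Obj C; f \<in> homs C X Y; f \<in> homs C X' Y'\<rbrakk>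
        \<Longrightarrow> X = X' \<and> Y = Y'"
    and Id_closed: "X \<in> Obj C \<Longrightarrow> Id C X \<in> homs C X X"
    and Id_left: "\<lbrakk>X \<in> Obj C; Y \<in> Obj C; f \<in> homs C X Y\<rbrakk> \<Longrightarrow> Id C Y \<cdot> f = f"
    and Id_right: "\<lbrakk>X \<in> Obj C; Y \<in> Obj C; f \<in> homs C X Y\<rbrakk> \<Longrightarrow> f \<cdot> Id C X = f"
    and Comp_assoc:
      "\<lbrakk>W \<in> Obj C; X \<in> Obj C; Y \<in> Obj C; Z \<in> Obj C;
        f \<in> homs C W X; g \<in> homs C X Y; h \<in> homs C Y Z\<rbrakk> \<Longrightarrow> (h \<cdot> g) \<cdot> f = h \<cdot> (g \<cdot> f)"
    and Comp_linear_left: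
      "\<lbrakk>X \<in> Obj C; Y \<in> Obj C; Z \<in> Obj C; f \<in> homs C X Y\<rbrakk>
        \<Longrightarrow> (\<lambda>g. g \<cdot> f) \<in> mod_hom R (Hom C Y Z) (Hom C X Z)"
    and Comp_linear_right:
      "\<lbrakk>X \<in> Obj C; Y \<in> Obj C; Z \<in> Obj C; g \<in> homs C Y Z\<rbrakk>
        \<Longrightarrow> (\<lambda>f. g \<cdot> f) \<in> mod_hom R (Hom C X Y) (Hom C X Z)"

definition is_zero_object :: "('r, 'o, 'm, 'c) lin_cat_scheme \<Rightarrow> 'o \<Rightarrow> bool"
  where "is_zero_object C Z \<longleftrightarrow> Z \<in> Obj C \<and>
    (\<forall>X \<in> Obj C. (\<exists>!f. f \<in> homs C X Z) \<and> (\<exists>!f. f \<in> homs C Z X))"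

definition is_biproduct :: "('r, 'o, 'm, 'c) lin_cat_scheme \<Rightarrow> 'o \<Rightarrow> 'o \<Rightarrow> 'o \<Rightarrow> bool"
  where "is_biproduct C X Y S \<longleftrightarrow> X \<in> Obj C \<and> Y \<in> Obj C \<and> S \<in> Obj C \<and>
    (\<exists>i \<in> homs C X S. \<exists>j \<in> homs C Y S. \<exists>p \<in> homs C S X. \<exists>q \<in> homs C S Y.
      p \<cdot>\<^bsub>C\<^esub> i = Id C X \<and> q \<cdot>\<^bsub>C\<^esub> j = Id C Y \<and>
      p \<cdot>\<^bsub>C\<^esub> j = \<zero>\<^bsub>Hom C Y X\<^esub> \<and> q \<cdot>\<^bsub>C\<^esub> i = \<zero>\<^bsub>Hom C X Y\<^esub> \<and>
      (i \<cdot>\<^bsub>C\<^esub> p) \<oplus>\<^bsub>Hom C S S\<^esub> (j \<cdot>\<^bsub>C\<^esub> q) = Id C S)"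

definition is_iso :: "('r, 'o, 'm, 'c) lin_cat_scheme \<Rightarrow> 'o \<Rightarrow> 'o \<Rightarrow> 'm \<Rightarrow> bool"
  where "is_iso C X Y f \<longleftrightarrow> f \<in> homs C X Y \<and>
    (\<exists>g \<in> homs C Y X. g \<cdot>\<^bsub>C\<^esub> f = Id C X \<and> f \<cdot>\<^bsub>C\<^esub> g = Id C Y)"

definition karoubian :: "('r, 'o, 'm, 'c) lin_cat_scheme \<Rightarrow> bool"
  where "karoubian C \<longleftrightarrow>
    (\<forall>X \<in> Obj C. \<forall>e \<in> homs C X X. e \<cdot>\<^bsub>C\<^esub> e = e \<longrightarrow>
      (\<exists>Y \<in> Obj C. \<exists>r \<in> homs C X Y. \<exists>s \<in> homs C Y X.
        s \<cdot>\<^bsub>C\<^esub> r = e \<and> r \<cdot>\<^bsub>C\<^esub> s = Id C Y))"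

text \<open>
  \<open>Sh\<close> and \<open>ShM\<close> are the action of the translation functor \<open>[1]\<close> on objects and on morphisms.
  A tuple \<open>(X, Y, Z, f, g, h)\<close> in \<open>Tri\<close> stands for the distinguished triangle with
  \<open>f : X \<rightarrow> Y\<close>, \<open>g : Y \<rightarrow> Z\<close> and \<open>h : Z \<rightarrow> X[1]\<close>.
\<close>

record ('r, 'o, 'm) tri_cat = "('r, 'o, 'm) lin_cat" +
  Sh :: "'o \<Rightarrow> 'o"
  ShM :: "'m \<Rightarrow> 'm"
  Tri :: "('o \<times> 'o \<times> 'o \<times> 'm \<times> 'm \<times> 'm) set"

definition cand_triangle ::
    "('r, 'o, 'm, 'c) tri_cat_scheme \<Rightarrow> 'o \<Rightarrow> 'o \<Rightarrow> 'o \<Rightarrow> 'm \<Rightarrow> 'm \<Rightarrow> 'm \<Rightarrow> bool"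
  where "cand_triangle C X Y Z f g h \<longleftrightarrow> X \<in> Obj C \<and> Y \<in> Obj C \<and> Z \<in> Obj C \<and>
    f \<in> homs C X Y \<and> g \<in> homs C Y Z \<and> h \<in> homs C Z (Sh C X)"

text \<open>
  The translation functor is an \<open>R\<close>-linear automorphism, as in Verdier's and Neeman's definition.
\<close>

locale triangulated_category =
  linear_category R C for R :: "('r, 'k) ring_scheme"
    and C :: "('r, 'o, 'm, 'c) tri_cat_scheme" (structure) +
  assumes zero_object: "\<exists>Z. is_zero_object C Z"
    and biproducts: "\<lbrakk>X \<in> Obj C; Y \<in> Obj C\<rbrakk> \<Longrightarrow> \<exists>S. is_biproduct C X Y S"
    and Sh_bij: "bij_betw (Sh C) (Obj C) (Obj C)"
    and ShM_linear: "\<lbrakk>X \<in> Obj C; Y \<in> Obj C\<rbrakk>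
        \<Longrightarrow> ShM C \<in> mod_hom R (Hom C X Y) (Hom C (Sh C X) (Sh C Y))"
    and ShM_bij: "\<lbrakk>X \<in> Obj C; Y \<in> Obj C\<rbrakk>
        \<Longrightarrow> bij_betw (ShM C) (homs C X Y) (homs C (Sh C X) (Sh C Y))"
    and ShM_Id: "X \<in> Obj C \<Longrightarrow> ShM C (Id C X) = Id C (Sh C X)"
    and ShM_Comp:
      "\<lbrakk>X \<in> Obj C; Y \<in> Obj C; Z \<in> Obj C; f \<in> homs C X Y; g \<in> homs C Y Z\<rbrakk>
        \<Longrightarrow> ShM C (g \<cdot> f) = ShM C g \<cdot> ShM C f"
    and Tri_cand: "(X, Y, Z, f, g, h) \<in> Tri C \<Longrightarrow> cand_triangle C X Y Z f g h"
    and TR0: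
      "\<lbrakk>(X, Y, Z, f, g, h) \<in> Tri C; cand_triangle C X' Y' Z' f' g' h';
        is_iso C X X' a; is_iso C Y Y' b; is_iso C Z Z' c;
        f' \<cdot> a = b \<cdot> f; g' \<cdot> b = c \<cdot> g; h' \<cdot> c = ShM C a \<cdot> h\<rbrakk>
        \<Longrightarrow> (X', Y', Z', f', g', h') \<in> Tri C"
    and TR1_Id:
      "\<lbrakk>X \<in> Obj C; is_zero_object C Z\<rbrakk>
        \<Longrightarrow> (X, X, Z, Id C X, \<zero>\<^bsub>Hom C X Z\<^esub>, \<zero>\<^bsub>Hom C Z (Sh C X)\<^esub>) \<in> Tri C"
    and TR1_cone:
      "\<lbrakk>X \<in> Obj C; Y \<in> Obj C; f \<in> homs C X Y\<rbrakk> \<Longrightarrow> \<exists>Z g h. (X, Y, Z, f, g, h) \<in> Tri C"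
    and TR2:
      "cand_triangle C X Y Z f g h \<Longrightarrow>
        (X, Y, Z, f, g, h) \<in> Tri C \<longleftrightarrow>
        (Y, Z, Sh C X, g, h, \<ominus>\<^bsub>Hom C (Sh C X) (Sh C Y)\<^esub> ShM C f) \<in> Tri C"
    and TR3:
      "\<lbrakk>(X, Y, Z, f, g, h) \<in> Tri C; (X', Y', Z', f', g', h') \<in> Tri C;
        a \<in> homs C X X'; b \<in> homs C Y Y'; f' \<cdot> a = b \<cdot> f\<rbrakk>
        \<Longrightarrow> \<exists>c \<in> homs C Z Z'. g' \<cdot> b = c \<cdot> g \<and> h' \<cdot> c = ShM C a \<cdot> h"
    and TR4:
      "\<lbrakk>(X, Y, Z', f, f', f'') \<in> Tri C; (Y, Z, X', g, g', g'') \<in> Tri C;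
        (X, Z, Y', g \<cdot> f, h', h'') \<in> Tri C\<rbrakk>
        \<Longrightarrow> \<exists>u \<in> homs C Z' Y'. \<exists>v \<in> homs C Y' X'.
              (Z', Y', X', u, v, ShM C f' \<cdot> g'') \<in> Tri C \<and>
              u \<cdot> f' = h' \<cdot> g \<and> h'' \<cdot> u = f'' \<and>
              v \<cdot> h' = g' \<and> g'' \<cdot> v = ShM C f \<cdot> h''"

text \<open>Full subcategories are given by their sets of objects.\<close>

definition precovering :: "('r, 'o, 'm, 'c) lin_cat_scheme \<Rightarrow> 'o set \<Rightarrow> bool"
  where "precovering C \<A> \<longleftrightarrow>
    (\<forall>D \<in> Obj C. \<exists>A \<in> \<A>. \<exists>p \<in> homs C A D.
      \<forall>X \<in> \<A>. (\<lambda>g. p \<cdot>\<^bsub>C\<^esub> g) ` homs C X A = homs C X D)"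

inductive_set smd :: "('r, 'o, 'm, 'c) lin_cat_scheme \<Rightarrow> 'o set \<Rightarrow> 'o set"
  for C :: "('r, 'o, 'm, 'c) lin_cat_scheme" and \<A> :: "'o set"
where
  base: "X \<in> \<A> \<Longrightarrow> X \<in> smd C \<A>"
| summand: "\<lbrakk>S \<in> smd C \<A>; is_biproduct C X Y S\<rbrakk> \<Longrightarrow> X \<in> smd C \<A>"

definition ext_prod :: "('r, 'o, 'm, 'c) tri_cat_scheme \<Rightarrow> 'o set \<Rightarrow> 'o set \<Rightarrow> 'o set"
  where "ext_prod C \<A> \<B> =
    {Y. \<exists>X \<in> \<A>. \<exists>Z \<in> \<B>. \<exists>f g h. (X, Y, Z, f, g, h) \<in> Tri C}"

text \<open>The powers \<open>\<A>\<^sup>*\<^sup>n\<close> are only meaningful for \<open>n \<ge> 1\<close>; the value at \<open>0\<close> is a dummy.\<close>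

fun ext_pow :: "('r, 'o, 'm, 'c) tri_cat_scheme \<Rightarrow> 'o set \<Rightarrow> nat \<Rightarrow> 'o set"
  where
    "ext_pow C \<A> 0 = {}"
  | "ext_pow C \<A> (Suc 0) = smd C \<A>"
  | "ext_pow C \<A> (Suc (Suc n)) = smd C (ext_prod C (ext_pow C \<A> (Suc n)) (ext_pow C \<A> (Suc 0)))"

record ('r, 'o, 'm, 'v) cfunctor =
  FObj :: "'o \<Rightarrow> ('r, 'v) module"
  FMor :: "'m \<Rightarrow> 'v \<Rightarrow> 'v"

definition contra_functor ::
    "('r, 'k) ring_scheme \<Rightarrow> ('r, 'o, 'm, 'c) lin_cat_scheme \<Rightarrow> ('r, 'o, 'm, 'v) cfunctor \<Rightarrow> bool"
  where "contra_functor R C F \<longleftrightarrow>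
    (\<forall>X \<in> Obj C. module R (FObj F X)) \<and>
    (\<forall>X \<in> Obj C. \<forall>Y \<in> Obj C. \<forall>f \<in> homs C X Y. FMor F f \<in> mod_hom R (FObj F Y) (FObj F X)) \<and>
    (\<forall>X \<in> Obj C. \<forall>x \<in> carrier (FObj F X). FMor F (Id C X) x = x) \<and>
    (\<forall>X \<in> Obj C. \<forall>Y \<in> Obj C. \<forall>Z \<in> Obj C. \<forall>f \<in> homs C X Y. \<forall>g \<in> homs C Y Z.
      \<forall>x \<in> carrier (FObj F Z). FMor F (g \<cdot>\<^bsub>C\<^esub> f) x = FMor F f (FMor F g x)) \<and>
    (\<forall>X \<in> Obj C. \<forall>Y \<in> Obj C. \<forall>f \<in> homs C X Y. \<forall>f' \<in> homs C X Y. \<forall>x \<in> carrier (FObj F Y).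
      FMor F (f \<oplus>\<^bsub>Hom C X Y\<^esub> f') x = FMor F f x \<oplus>\<^bsub>FObj F X\<^esub> FMor F f' x) \<and>
    (\<forall>X \<in> Obj C. \<forall>Y \<in> Obj C. \<forall>r \<in> carrier R. \<forall>f \<in> homs C X Y. \<forall>x \<in> carrier (FObj F Y).
      FMor F (r \<odot>\<^bsub>Hom C X Y\<^esub> f) x = r \<odot>\<^bsub>FObj F X\<^esub> FMor F f x)"

definition hom_functor ::
    "('r, 'o, 'm, 'c) lin_cat_scheme \<Rightarrow> 'o \<Rightarrow> ('r, 'o, 'm, 'm) cfunctor"
  where "hom_functor C D = \<lparr>FObj = (\<lambda>X. Hom C X D), FMor = (\<lambda>f g. g \<cdot>\<^bsub>C\<^esub> f)\<rparr>"

definition cohomological ::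
    "('r, 'k) ring_scheme \<Rightarrow> ('r, 'o, 'm, 'c) tri_cat_scheme \<Rightarrow> ('r, 'o, 'm, 'v) cfunctor \<Rightarrow> bool"
  where "cohomological R C F \<longleftrightarrow> contra_functor R C F \<and>
    (\<forall>X Y Z f g h. (X, Y, Z, f, g, h) \<in> Tri C \<longrightarrow>
      FMor F g ` carrier (FObj F Z) = {y \<in> carrier (FObj F Y). FMor F f y = \<zero>\<^bsub>FObj F X\<^esub>})"

definition nat_trans ::
    "('r, 'k) ring_scheme \<Rightarrow> ('r, 'o, 'm, 'c) lin_cat_scheme \<Rightarrow> ('r, 'o, 'm, 'v) cfunctor \<Rightarrow>
      ('r, 'o, 'm, 'w) cfunctor \<Rightarrow> ('o \<Rightarrow> 'v \<Rightarrow> 'w) \<Rightarrow> bool"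
  where "nat_trans R C F G \<alpha> \<longleftrightarrow>
    (\<forall>X \<in> Obj C. \<alpha> X \<in> mod_hom R (FObj F X) (FObj G X)) \<and>
    (\<forall>X \<in> Obj C. \<forall>Y \<in> Obj C. \<forall>f \<in> homs C X Y. \<forall>y \<in> carrier (FObj F Y).
      \<alpha> X (FMor F f y) = FMor G f (\<alpha> Y y))"

definition functor_iso ::
    "('r, 'k) ring_scheme \<Rightarrow> ('r, 'o, 'm, 'c) lin_cat_scheme \<Rightarrow> ('r, 'o, 'm, 'v) cfunctor \<Rightarrow>
      ('r, 'o, 'm, 'w) cfunctor \<Rightarrow> bool"
  where "functor_iso R C F G \<longleftrightarrow>
    (\<exists>\<alpha>. nat_trans R C F G \<alpha> \<and>
      (\<forall>X \<in> Obj C. bij_betw (\<alpha> X) (carrier (FObj F X)) (carrier (FObj G X))))"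

definition subfunctor ::
    "('r, 'k) ring_scheme \<Rightarrow> ('r, 'o, 'm, 'c) lin_cat_scheme \<Rightarrow> ('r, 'o, 'm, 'v) cfunctor \<Rightarrow>
      ('o \<Rightarrow> 'v set) \<Rightarrow> bool"
  where "subfunctor R C F S \<longleftrightarrow>
    (\<forall>X \<in> Obj C. submodule (S X) R (FObj F X)) \<and>
    (\<forall>X \<in> Obj C. \<forall>Y \<in> Obj C. \<forall>f \<in> homs C X Y. FMor F f ` S Y \<subseteq> S X)"

definition restrict_functor ::
    "('r, 'o, 'm, 'v) cfunctor \<Rightarrow> ('o \<Rightarrow> 'v set) \<Rightarrow> ('r, 'o, 'm, 'v) cfunctor"
  where "restrict_functor F S = F\<lparr>FObj := (\<lambda>X. (FObj F X)\<lparr>carrier := S X\<rparr>)\<rparr>"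

definition kernel_functor ::
    "('r, 'o, 'm, 'v) cfunctor \<Rightarrow> ('r, 'o, 'm, 'w) cfunctor \<Rightarrow> ('o \<Rightarrow> 'v \<Rightarrow> 'w) \<Rightarrow>
      ('r, 'o, 'm, 'v) cfunctor"
  where "kernel_functor F G \<alpha> =
    restrict_functor F (\<lambda>X. {x \<in> carrier (FObj F X). \<alpha> X x = \<zero>\<^bsub>FObj G X\<^esub>})"

text \<open>
  The direct sum decomposition is internal to \<open>F\<close>, so the values of the complement live in the
  same type as those of \<open>F\<close>.
\<close>

definition iso_to_direct_summand ::
    "('r, 'k) ring_scheme \<Rightarrow> ('r, 'o, 'm, 'c) lin_cat_scheme \<Rightarrow> ('r, 'o, 'm, 'w) cfunctor \<Rightarrow>
      ('r, 'o, 'm, 'v) cfunctor \<Rightarrow> bool"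
  where "iso_to_direct_summand R C G F \<longleftrightarrow>
    (\<exists>S T. subfunctor R C F S \<and> subfunctor R C F T \<and>
      (\<forall>X \<in> Obj C. S X \<inter> T X = {\<zero>\<^bsub>FObj F X\<^esub>} \<and>
        (\<forall>x \<in> carrier (FObj F X). \<exists>s \<in> S X. \<exists>t \<in> T X. x = s \<oplus>\<^bsub>FObj F X\<^esub> t)) \<and>
      functor_iso R C G (restrict_functor F S))"

definition representable ::
    "('r, 'k) ring_scheme \<Rightarrow> ('r, 'o, 'm, 'c) lin_cat_scheme \<Rightarrow> ('r, 'o, 'm, 'v) cfunctor \<Rightarrow> bool"
  where "representable R C F \<longleftrightarrow> (\<exists>X \<in> Obj C. functor_iso R C F (hom_functor C X))"

definition finitely_generated_on ::
    "('r, 'k) ring_scheme \<Rightarrow> ('r, 'o, 'm, 'c) lin_cat_scheme \<Rightarrow> 'o set \<Rightarrow>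
      ('r, 'o, 'm, 'v) cfunctor \<Rightarrow> bool"
  where "finitely_generated_on R C \<A> F \<longleftrightarrow>
    (\<exists>A \<in> \<A>. \<exists>\<alpha>. nat_trans R C (hom_functor C A) F \<alpha> \<and>
      (\<forall>X \<in> \<A>. \<alpha> X ` homs C X A = carrier (FObj F X)))"

end

theory Submission
  imports Defs "HOL-Algebra.AbelCoset"
begin

text \<open>
  By Yoneda a map \<open>Hom(-, E) \<rightarrow> M\<close> is an element \<open>e \<in> M(E)\<close>, acting by \<open>x \<mapsto> M(x)(e)\<close>.  Consider
  pairs \<open>(E, e)\<close>, with maps \<open>t : E \<rightarrow> E'\<close> such that \<open>M(t)(e') = e\<close> as morphisms (\<open>refines\<close>).  At an
  object \<open>X\<close> the pair \<open>(E, e)\<close> can \<^emph>\<open>cover\<close> \<open>X\<close>, that is, \<open>Hom(X, E) \<rightarrow> M(X)\<close> is onto, and \<open>t\<close> can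
  \<^emph>\<open>kill\<close> \<open>X\<close>, that is, composition with \<open>t\<close> annihilates the kernel of \<open>Hom(X, E) \<rightarrow> M(X)\<close>.  Both
  persist under further refinement.

  Finite generation of \<open>M\<close> gives a pair that covers \<open>\<A>\<close>.  Finite generation of the kernels gives,
  for each pair \<open>(E, e)\<close>, a map \<open>u : A \<rightarrow> E\<close> with \<open>A \<in> \<A>\<close> onto the kernel over \<open>\<A>\<close>; since \<open>M\<close> is
  cohomological and \<open>M(u)(e) = 0\<close>, the element \<open>e\<close> extends over the cone \<open>E \<rightarrow> E'\<close> of \<open>u\<close>, and
  this map kills \<open>\<A>\<close> (\<open>controlled_base\<close>).  Call a class \<open>\<B>\<close> \<^emph>\<open>controlled\<close> if every pair that covers
  \<open>\<A>\<close> has a refinement that covers and kills \<open>\<B>\<close>.  Being controlled is inherited by direct summands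
  and, for shift-stable classes, by extensions: given a triangle \<open>X \<rightarrow> Y \<rightarrow> Z \<rightarrow> X[1]\<close>, refine first
  for \<open>X\<close>, then for \<open>Z\<close>, and chase the two long exact sequences as in the five lemma
  (\<open>kills_extension\<close>, \<open>covers_extension\<close>).  Hence all \<open>\<A>\<^sup>*\<^sup>n\<close>, and so the whole category, are
  controlled.

  Refining twice, \<open>(E\<^sub>1, e\<^sub>1) \<rightarrow> (E, e)\<close> via \<open>t\<close>, the pair \<open>(E\<^sub>1, e\<^sub>1)\<close> covers everything and
  \<open>t\<close> kills everything.  So composition with \<open>t\<close> factors as
  \<open>Hom(-, E\<^sub>1) \<rightarrow> M \<rightarrow> Hom(-, E)\<close>, and the second map is a section of the map
  \<open>Hom(-, E) \<rightarrow> M\<close> given by \<open>e\<close>.  The resulting idempotent of \<open>Hom(-, E)\<close> is composition with an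
  idempotent \<open>s\<close> of \<open>E\<close> (\<open>ex_projector\<close>), \<open>M\<close> is the summand of \<open>Hom(-, E)\<close> cut out by \<open>s\<close>, and if
  \<open>s\<close> splits through \<open>Y\<close>, this summand is \<open>Hom(-, Y)\<close>.
\<close>

section \<open>Linear maps, linear categories and linear functors\<close>

lemma abelian_group_diff_eq_zero_iff:
  assumes "abelian_group G" "a \<in> carrier G" "b \<in> carrier G"
  shows "a \<ominus>\<^bsub>G\<^esub> b = \<zero>\<^bsub>G\<^esub> \<longleftrightarrow> a = b"
proof -
  interpret abelian_group G by fact
  show ?thesis
    using assms(2,3) by (metis a_minus_def minus_equality minus_minus r_neg add.inv_closed)
qed

lemma mod_hom_group_hom:
  assumes "module R M" "module R N" "\<phi> \<in> mod_hom R M N"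
  shows "abelian_group_hom M N \<phi>"
  using assms
  by (intro abelian_group_homI group_hom.intro group_hom_axioms.intro)
    (auto simp: module_def mod_hom_def hom_def intro: abelian_group.a_group)

lemma mod_hom_closed: "\<lbrakk>\<phi> \<in> mod_hom R M N; x \<in> carrier M\<rbrakk> \<Longrightarrow> \<phi> x \<in> carrier N"
  and mod_hom_add: "\<lbrakk>\<phi> \<in> mod_hom R M N; x \<in> carrier M; y \<in> carrier M\<rbrakk>
      \<Longrightarrow> \<phi> (x \<oplus>\<^bsub>M\<^esub> y) = \<phi> x \<oplus>\<^bsub>N\<^esub> \<phi> y"
  and mod_hom_smult: "\<lbrakk>\<phi> \<in> mod_hom R M N; r \<in> carrier R; x \<in> carrier M\<rbrakk>
      \<Longrightarrow> \<phi> (r \<odot>\<^bsub>M\<^esub> x) = r \<odot>\<^bsub>N\<^esub> \<phi> x"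
  unfolding mod_hom_def by auto

lemma mod_hom_zero:
  "\<lbrakk>module R M; module R N; \<phi> \<in> mod_hom R M N\<rbrakk> \<Longrightarrow> \<phi> \<zero>\<^bsub>M\<^esub> = \<zero>\<^bsub>N\<^esub>"
  by (rule abelian_group_hom.hom_zero[OF mod_hom_group_hom])

lemma mod_hom_neg:
  "\<lbrakk>module R M; module R N; \<phi> \<in> mod_hom R M N; x \<in> carrier M\<rbrakk>
    \<Longrightarrow> \<phi> (\<ominus>\<^bsub>M\<^esub> x) = \<ominus>\<^bsub>N\<^esub> \<phi> x"
  by (rule abelian_group_hom.hom_a_inv[OF mod_hom_group_hom])

lemma mod_hom_diff:
  assumes "module R M" "module R N" "\<phi> \<in> mod_hom R M N" "x \<in> carrier M" "y \<in> carrier M"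
  shows "\<phi> (x \<ominus>\<^bsub>M\<^esub> y) = \<phi> x \<ominus>\<^bsub>N\<^esub> \<phi> y"
proof -
  interpret abelian_group M using assms(1) by (simp add: module_def)
  show ?thesis
    using assms mod_hom_add[OF assms(3)] mod_hom_neg[OF assms(1-3)]
    by (simp add: a_minus_def)
qed

context linear_category
begin

lemma hom_group: "\<lbrakk>X \<in> Obj C; Y \<in> Obj C\<rbrakk> \<Longrightarrow> abelian_group (Hom C X Y)"
  using Hom_module by (simp add: module_def)

lemma zero_closed: "\<lbrakk>X \<in> Obj C; Y \<in> Obj C\<rbrakk> \<Longrightarrow> \<zero>\<^bsub>Hom C X Y\<^esub> \<in> homs C X Y"
  and neg_closed: "\<lbrakk>X \<in> Obj C; Y \<in> Obj C; f \<in> homs C X Y\<rbrakk> \<Longrightarrow> \<ominus>\<^bsub>Hom C X Y\<^esub> f \<in> homs C X Y"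
  and neg_neg: "\<lbrakk>X \<in> Obj C; Y \<in> Obj C; f \<in> homs C X Y\<rbrakk>
      \<Longrightarrow> \<ominus>\<^bsub>Hom C X Y\<^esub> (\<ominus>\<^bsub>Hom C X Y\<^esub> f) = f"
  and neg_zero: "\<lbrakk>X \<in> Obj C; Y \<in> Obj C\<rbrakk> \<Longrightarrow> \<ominus>\<^bsub>Hom C X Y\<^esub> \<zero>\<^bsub>Hom C X Y\<^esub> = \<zero>\<^bsub>Hom C X Y\<^esub>"
  using hom_group
  by (auto simp: abelian_group.minus_minus abelian_monoid.zero_closed abelian_group.axioms
      abelian_group.a_inv_closed abelian_group.minus_equality abelian_monoid.l_zero)

lemma add_closed: "\<lbrakk>X \<in> Obj C; Y \<in> Obj C; f \<in> homs C X Y; g \<in> homs C X Y\<rbrakk>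
      \<Longrightarrow> f \<oplus>\<^bsub>Hom C X Y\<^esub> g \<in> homs C X Y"
  and diff_closed: "\<lbrakk>X \<in> Obj C; Y \<in> Obj C; f \<in> homs C X Y; g \<in> homs C X Y\<rbrakk>
      \<Longrightarrow> f \<ominus>\<^bsub>Hom C X Y\<^esub> g \<in> homs C X Y"
  using hom_group
  by (auto simp: abelian_group.minus_closed abelian_monoid.a_closed abelian_group.axioms)

lemma diff_eq_zero_iff: "\<lbrakk>X \<in> Obj C; Y \<in> Obj C; f \<in> homs C X Y; g \<in> homs C X Y\<rbrakk>
      \<Longrightarrow> f \<ominus>\<^bsub>Hom C X Y\<^esub> g = \<zero>\<^bsub>Hom C X Y\<^esub> \<longleftrightarrow> f = g"
  using abelian_group_diff_eq_zero_iff hom_group by metis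

lemma comp_closed:
  "\<lbrakk>X \<in> Obj C; Y \<in> Obj C; Z \<in> Obj C; f \<in> homs C X Y; g \<in> homs C Y Z\<rbrakk> \<Longrightarrow> g \<cdot> f \<in> homs C X Z"
  by (rule mod_hom_closed[OF Comp_linear_right])

lemma comp_zero_right:
  "\<lbrakk>X \<in> Obj C; Y \<in> Obj C; Z \<in> Obj C; g \<in> homs C Y Z\<rbrakk> \<Longrightarrow> g \<cdot> \<zero>\<^bsub>Hom C X Y\<^esub> = \<zero>\<^bsub>Hom C X Z\<^esub>"
  by (rule mod_hom_zero[OF _ _ Comp_linear_right]) (auto intro: Hom_module)

lemma comp_zero_left:
  "\<lbrakk>X \<in> Obj C; Y \<in> Obj C; Z \<in> Obj C; f \<in> homs C X Y\<rbrakk> \<Longrightarrow> \<zero>\<^bsub>Hom C Y Z\<^esub> \<cdot> f = \<zero>\<^bsub>Hom C X Z\<^esub>"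
  by (rule mod_hom_zero[OF _ _ Comp_linear_left]) (auto intro: Hom_module)

lemma comp_diff_right:
  "\<lbrakk>X \<in> Obj C; Y \<in> Obj C; Z \<in> Obj C; f \<in> homs C X Y; f' \<in> homs C X Y; g \<in> homs C Y Z\<rbrakk>
    \<Longrightarrow> g \<cdot> (f \<ominus>\<^bsub>Hom C X Y\<^esub> f') = (g \<cdot> f) \<ominus>\<^bsub>Hom C X Z\<^esub> (g \<cdot> f')"
  by (rule mod_hom_diff[OF _ _ Comp_linear_right]) (auto intro: Hom_module)

lemmas comp_add_right = mod_hom_add[OF Comp_linear_right]
lemmas comp_smult_right = mod_hom_smult[OF Comp_linear_right]

end

locale linear_functor = linear_category R C
  for R :: "('r, 'k) ring_scheme" and C :: "('r, 'o, 'm, 'c) lin_cat_scheme" (structure) +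
  fixes M :: "('r, 'o, 'm, 'v) cfunctor"
  assumes contra_functor: "contra_functor R C M"
begin

abbreviation val :: "'o \<Rightarrow> 'v set"
  where "val X \<equiv> carrier (FObj M X)"

lemma val_module: "X \<in> Obj C \<Longrightarrow> module R (FObj M X)"
  and act_mod_hom: "\<lbrakk>X \<in> Obj C; Y \<in> Obj C; f \<in> homs C X Y\<rbrakk>
      \<Longrightarrow> FMor M f \<in> mod_hom R (FObj M Y) (FObj M X)"
  and act_Id: "\<lbrakk>X \<in> Obj C; m \<in> val X\<rbrakk> \<Longrightarrow> FMor M (Id C X) m = m"
  and act_Comp: "\<lbrakk>X \<in> Obj C; Y \<in> Obj C; Z \<in> Obj C; f \<in> homs C X Y; g \<in> homs C Y Z; m \<in> val Z\<rbrakk>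
      \<Longrightarrow> FMor M (g \<cdot> f) m = FMor M f (FMor M g m)"
  using contra_functor unfolding contra_functor_def by metis+

lemma val_group: "X \<in> Obj C \<Longrightarrow> abelian_group (FObj M X)"
  using val_module by (simp add: module_def)

lemma val_diff_eq_zero_iff: "\<lbrakk>X \<in> Obj C; m \<in> val X; m' \<in> val X\<rbrakk>
      \<Longrightarrow> m \<ominus>\<^bsub>FObj M X\<^esub> m' = \<zero>\<^bsub>FObj M X\<^esub> \<longleftrightarrow> m = m'"
  using abelian_group_diff_eq_zero_iff val_group by metis

lemma val_diff_closed: "\<lbrakk>X \<in> Obj C; m \<in> val X; m' \<in> val X\<rbrakk> \<Longrightarrow> m \<ominus>\<^bsub>FObj M X\<^esub> m' \<in> val X"
  using val_group abelian_group.minus_closed by metis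

lemma act_closed: "\<lbrakk>X \<in> Obj C; Y \<in> Obj C; f \<in> homs C X Y; m \<in> val Y\<rbrakk> \<Longrightarrow> FMor M f m \<in> val X"
  by (rule mod_hom_closed[OF act_mod_hom])

lemma act_zero:
  "\<lbrakk>X \<in> Obj C; Y \<in> Obj C; f \<in> homs C X Y\<rbrakk> \<Longrightarrow> FMor M f \<zero>\<^bsub>FObj M Y\<^esub> = \<zero>\<^bsub>FObj M X\<^esub>"
  by (rule mod_hom_zero[OF _ _ act_mod_hom]) (auto intro: val_module)

lemma act_diff:
  "\<lbrakk>X \<in> Obj C; Y \<in> Obj C; f \<in> homs C X Y; m \<in> val Y; m' \<in> val Y\<rbrakk>
    \<Longrightarrow> FMor M f (m \<ominus>\<^bsub>FObj M Y\<^esub> m') = FMor M f m \<ominus>\<^bsub>FObj M X\<^esub> FMor M f m'"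
  by (rule mod_hom_diff[OF _ _ act_mod_hom]) (auto intro: val_module)

text \<open>
  The maps out of a representable functor are the evaluations at an element (Yoneda), which is why
  all arguments about natural transformations into \<open>M\<close> are carried out with elements of \<open>M\<close>.
\<close>

lemma eval_mod_hom:
  "\<lbrakk>X \<in> Obj C; E \<in> Obj C; e \<in> val E\<rbrakk> \<Longrightarrow> (\<lambda>x. FMor M x e) \<in> mod_hom R (Hom C X E) (FObj M X)"
  using contra_functor act_closed unfolding contra_functor_def mod_hom_def by simp

lemmas eval_add = mod_hom_add[OF eval_mod_hom]

lemma eval_diff:
  "\<lbrakk>X \<in> Obj C; E \<in> Obj C; e \<in> val E; x \<in> homs C X E; y \<in> homs C X E\<rbrakk>
    \<Longrightarrow> FMor M (x \<ominus>\<^bsub>Hom C X E\<^esub> y) e = FMor M x e \<ominus>\<^bsub>FObj M X\<^esub> FMor M y e"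
  by (rule mod_hom_diff[OF _ _ eval_mod_hom]) (auto intro: val_module Hom_module)

lemma eval_nat_trans:
  "\<lbrakk>E \<in> Obj C; e \<in> val E\<rbrakk> \<Longrightarrow> nat_trans R C (hom_functor C E) M (\<lambda>X x. FMor M x e)"
  unfolding nat_trans_def hom_functor_def by (auto simp: eval_mod_hom act_Comp)

lemma nat_trans_eq_eval:
  assumes "nat_trans R C (hom_functor C E) M \<alpha>" "E \<in> Obj C" "X \<in> Obj C" "x \<in> homs C X E"
  shows "\<alpha> X x = FMor M x (\<alpha> E (Id C E))"
proof -
  have "\<alpha> X (Id C E \<cdot> x) = FMor M x (\<alpha> E (Id C E))"
    using assms Id_closed unfolding nat_trans_def hom_functor_def by simp
  then show ?thesis using assms Id_left by simp
qed

end

section \<open>Triangles\<close>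

context triangulated_category
begin

lemma Sh_obj: "X \<in> Obj C \<Longrightarrow> Sh C X \<in> Obj C"
  using Sh_bij by (auto simp: bij_betw_def)

lemma Sh_surj: "X \<in> Obj C \<Longrightarrow> \<exists>X' \<in> Obj C. X = Sh C X'"
  using Sh_bij by (auto simp: bij_betw_def)

lemma ShM_surj:
  "\<lbrakk>X \<in> Obj C; Y \<in> Obj C; f \<in> homs C (Sh C X) (Sh C Y)\<rbrakk> \<Longrightarrow> \<exists>g \<in> homs C X Y. ShM C g = f"
  unfolding bij_betw_imp_surj_on[OF ShM_bij, symmetric] by blast

lemma ShM_eq_iff:
  "\<lbrakk>X \<in> Obj C; Y \<in> Obj C; f \<in> homs C X Y; g \<in> homs C X Y\<rbrakk> \<Longrightarrow> ShM C f = ShM C g \<longleftrightarrow> f = g"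
  using ShM_bij[of X Y] by (auto simp: bij_betw_def inj_on_def)

lemma ShM_zero:
  "\<lbrakk>X \<in> Obj C; Y \<in> Obj C\<rbrakk> \<Longrightarrow> ShM C \<zero>\<^bsub>Hom C X Y\<^esub> = \<zero>\<^bsub>Hom C (Sh C X) (Sh C Y)\<^esub>"
  by (rule mod_hom_zero[OF _ _ ShM_linear]) (auto intro: Hom_module Sh_obj)

lemma ShM_add: "\<lbrakk>X \<in> Obj C; Y \<in> Obj C; f \<in> homs C X Y; g \<in> homs C X Y\<rbrakk>
    \<Longrightarrow> ShM C (f \<oplus>\<^bsub>Hom C X Y\<^esub> g) = ShM C f \<oplus>\<^bsub>Hom C (Sh C X) (Sh C Y)\<^esub> ShM C g"
  by (rule mod_hom_add[OF ShM_linear])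

lemma ShM_bex_iff:
  assumes "X \<in> Obj C" "Y \<in> Obj C"
  shows "(\<exists>f \<in> homs C (Sh C X) (Sh C Y). P f) \<longleftrightarrow> (\<exists>f \<in> homs C X Y. P (ShM C f))"
  unfolding bij_betw_imp_surj_on[OF ShM_bij[OF assms], symmetric] by blast

lemma is_zero_object_Sh:
  assumes Z: "is_zero_object C Z"
  shows "is_zero_object C (Sh C Z)"
proof -
  have ZO: "Z \<in> Obj C" using Z by (simp add: is_zero_object_def)
  have "(\<exists>!f. f \<in> homs C X (Sh C Z)) \<and> (\<exists>!f. f \<in> homs C (Sh C Z) X)" if X: "X \<in> Obj C" for X
  proof -
    obtain X' where X': "X' \<in> Obj C" "X = Sh C X'" using Sh_surj X by blast
    have "homs C X (Sh C Z) = ShM C ` homs C X' Z" "homs C (Sh C Z) X = ShM C ` homs C Z X'"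
      using ShM_bij ZO X' by (simp_all add: bij_betw_def)
    moreover have "\<exists>!f. f \<in> homs C X' Z" "\<exists>!f. f \<in> homs C Z X'"
      using Z X'(1) by (auto simp: is_zero_object_def)
    moreover have "\<exists>!f. f \<in> \<phi> ` A" if "\<exists>!f. f \<in> A" for \<phi> :: "'m \<Rightarrow> 'm" and A
      using that by blast
    ultimately show ?thesis by (simp only:)
  qed
  then show ?thesis using ZO Sh_obj by (simp add: is_zero_object_def)
qed

text \<open>
  The translation is bijective on hom-sets, so the data of a biproduct and each of its equations
  can be moved in both directions.
\<close>

lemma is_biproduct_Sh_iff:
  assumes "X \<in> Obj C" "Y \<in> Obj C" "S \<in> Obj C"
  shows "is_biproduct C (Sh C X) (Sh C Y) (Sh C S) \<longleftrightarrow> is_biproduct C X Y S"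
proof -
  have comp: "ShM C p \<cdot> ShM C i = ShM C g \<longleftrightarrow> p \<cdot> i = g"
    if "W \<in> Obj C" "V \<in> Obj C" "U \<in> Obj C"
      "i \<in> homs C W V" "p \<in> homs C V U" "g \<in> homs C W U" for W V U i p g
    using that ShM_eq_iff[of W U "p \<cdot> i" g]
    by (simp add: ShM_Comp[symmetric, of W V U] comp_closed[of W V U])
  have sum: "(ShM C i \<cdot> ShM C p) \<oplus>\<^bsub>Hom C (Sh C S) (Sh C S)\<^esub> (ShM C j \<cdot> ShM C q)
      = ShM C (Id C S) \<longleftrightarrow> (i \<cdot> p) \<oplus>\<^bsub>Hom C S S\<^esub> (j \<cdot> q) = Id C S"
    if "i \<in> homs C X S" "j \<in> homs C Y S" "p \<in> homs C S X" "q \<in> homs C S Y" for i j p q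
    using that assms ShM_eq_iff[of S S "(i \<cdot> p) \<oplus>\<^bsub>Hom C S S\<^esub> (j \<cdot> q)" "Id C S"]
    by (simp add: ShM_Comp[symmetric, of S _ S] ShM_add[symmetric] Id_closed
        comp_closed[of S _ S] add_closed)
  note zeroes = ShM_zero[symmetric] ShM_Id[symmetric]
  show ?thesis
    unfolding is_biproduct_def using assms
    by (simp only: ShM_bex_iff Sh_obj zeroes simp_thms, intro bex_cong refl,
        simp only: comp sum Id_closed zero_closed)
qed

lemma triangleD:
  assumes "(X, Y, Z, f, g, h) \<in> Tri C"
  shows "X \<in> Obj C" "Y \<in> Obj C" "Z \<in> Obj C"
    "f \<in> homs C X Y" "g \<in> homs C Y Z" "h \<in> homs C Z (Sh C X)"
  using Tri_cand[OF assms] unfolding cand_triangle_def by blast+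

lemma triangle_rotate:
  assumes "(X, Y, Z, f, g, h) \<in> Tri C"
  shows "(Y, Z, Sh C X, g, h, \<ominus>\<^bsub>Hom C (Sh C X) (Sh C Y)\<^esub> ShM C f) \<in> Tri C"
  by (rule iffD1[OF TR2[OF Tri_cand[OF assms]] assms])

lemma triangle_rotate_back:
  assumes T: "(X, Y, Z, f, g, h) \<in> Tri C" and Z': "Z' \<in> Obj C" "Z = Sh C Z'"
  shows "\<exists>u. (Z', X, Y, u, f, g) \<in> Tri C"
proof -
  note t = triangleD[OF T]
  have ZX: "Sh C Z' \<in> Obj C" "Sh C X \<in> Obj C" using Z' t Sh_obj by auto
  have h: "h \<in> homs C (Sh C Z') (Sh C X)" using t(6) Z'(2) by simp
  obtain u where u: "u \<in> homs C Z' X" "ShM C u = \<ominus>\<^bsub>Hom C (Sh C Z') (Sh C X)\<^esub> h"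
    using ShM_surj[OF Z'(1) t(1) neg_closed[OF ZX h]] ..
  have "h = \<ominus>\<^bsub>Hom C (Sh C Z') (Sh C X)\<^esub> ShM C u" using neg_neg[OF ZX h] u(2) by simp
  then have "(Z', X, Y, u, f, g) \<in> Tri C"
    using TR2[of Z' X Y u f g] T Z' t u by (simp add: cand_triangle_def)
  then show ?thesis ..
qed

text \<open>
  Three rotations shift a triangle by one, up to signs of the maps.
\<close>

lemma triangle_Sh:
  assumes "(X, Y, Z, f, g, h) \<in> Tri C"
  shows "\<exists>f g h. (Sh C X, Sh C Y, Sh C Z, f, g, h) \<in> Tri C"
  using triangle_rotate[OF triangle_rotate[OF triangle_rotate[OF assms]]] by blast

lemma triangle_unSh:
  assumes "(Sh C X, Sh C Y, Sh C Z, f, g, h) \<in> Tri C" "X \<in> Obj C" "Y \<in> Obj C" "Z \<in> Obj C"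
  shows "\<exists>f g h. (X, Y, Z, f, g, h) \<in> Tri C"
proof -
  obtain u where u: "(Z, Sh C X, Sh C Y, u, f, g) \<in> Tri C"
    using triangle_rotate_back[OF assms(1,4) refl] ..
  obtain v where v: "(Y, Z, Sh C X, v, u, f) \<in> Tri C"
    using triangle_rotate_back[OF u assms(3) refl] ..
  obtain w where "(X, Y, Z, w, v, u) \<in> Tri C"
    using triangle_rotate_back[OF v assms(2) refl] ..
  then show ?thesis by blast
qed

text \<open>
  The pair \<open>(id, f)\<close> extends to a morphism from the triangle \<open>X \<rightarrow> X \<rightarrow> 0\<close>, so \<open>g \<cdot> f\<close> factors
  through \<open>0\<close>.
\<close>

lemma triangle_comp_zero:
  assumes T: "(X, Y, Z, f, g, h) \<in> Tri C"
  shows "g \<cdot> f = \<zero>\<^bsub>Hom C X Z\<^esub>"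
proof -
  note t = triangleD[OF T]
  obtain N where N: "is_zero_object C N" using zero_object by blast
  have NO: "N \<in> Obj C" using N by (simp add: is_zero_object_def)
  obtain c where "c \<in> homs C N Z" "g \<cdot> f = c \<cdot> \<zero>\<^bsub>Hom C X N\<^esub>"
    using TR3[OF TR1_Id[OF t(1) N] T Id_closed[OF t(1)] t(4)] by auto
  then show ?thesis using comp_zero_right NO t by simp
qed

text \<open>
  A map \<open>Y \<rightarrow> E\<close> that vanishes on \<open>X\<close> is the middle component of a morphism to the trivial triangle
  \<open>0 \<rightarrow> E \<rightarrow> E\<close>; its third component is the extension to \<open>Z\<close>.
\<close>

lemma triangle_extend:
  assumes T: "(X, Y, Z, f, g, h) \<in> Tri C"
    and E: "E \<in> Obj C" and y: "y \<in> homs C Y E" and yf: "y \<cdot> f = \<zero>\<^bsub>Hom C X E\<^esub>"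
  shows "\<exists>z \<in> homs C Z E. y = z \<cdot> g"
proof -
  note t = triangleD[OF T]
  obtain N where N: "is_zero_object C N" using zero_object by blast
  have NO: "N \<in> Obj C" using N by (simp add: is_zero_object_def)
  have T0: "(N, E, E, \<zero>\<^bsub>Hom C N E\<^esub>, Id C E, \<zero>\<^bsub>Hom C E (Sh C N)\<^esub>) \<in> Tri C"
    using TR1_Id[OF E is_zero_object_Sh[OF N]] TR2[of N E E] NO E
    by (simp add: cand_triangle_def Id_closed zero_closed Sh_obj ShM_zero neg_zero)
  obtain c where "c \<in> homs C Z E" "Id C E \<cdot> y = c \<cdot> g"
    using TR3[OF T T0 zero_closed[OF t(1) NO] y] comp_zero_right[OF t(1) NO E] yf
    by (auto simp: zero_closed NO E)
  then show ?thesis using Id_left[OF t(2) E y] by metis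
qed

end

section \<open>Extension powers\<close>

context triangulated_category
begin

lemma is_biproductD:
  assumes "is_biproduct C X Y S"
  shows "X \<in> Obj C" "Y \<in> Obj C" "S \<in> Obj C"
    "\<exists>i \<in> homs C X S. \<exists>p \<in> homs C S X. p \<cdot> i = Id C X"
  using assms unfolding is_biproduct_def by blast+

lemma smd_subset:
  assumes "\<A> \<subseteq> Obj C"
  shows "smd C \<A> \<subseteq> Obj C"
proof
  fix X assume "X \<in> smd C \<A>"
  then show "X \<in> Obj C" by induction (use assms is_biproductD in blast)+
qed

lemma ext_prod_subset: "ext_prod C \<A> \<B> \<subseteq> Obj C"
  unfolding ext_prod_def using triangleD(2) by blast

lemma ext_pow_subset: "\<A> \<subseteq> Obj C \<Longrightarrow> ext_pow C \<A> n \<subseteq> Obj C"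
  by (cases "(C, \<A>, n)" rule: ext_pow.cases)
    (simp_all add: smd_subset ext_prod_subset)

text \<open>
  The chase in an extension \<open>X \<rightarrow> Y \<rightarrow> Z\<close> needs information at \<open>X[1]\<close> and at \<open>Z[-1]\<close>.  Stability of
  \<open>\<A>\<^sup>*\<^sup>n\<close> under the translation and its inverse, which is the content of the equalities below,
  supplies it.
\<close>

lemma Sh_image_smd:
  assumes \<A>: "\<A> \<subseteq> Obj C" and Sh: "Sh C ` \<A> = \<A>"
  shows "Sh C ` smd C \<A> = smd C \<A>"
proof (intro equalityI subsetI)
  fix X assume "X \<in> Sh C ` smd C \<A>"
  then obtain X' where X: "X = Sh C X'" and "X' \<in> smd C \<A>" by blast
  from this(2) have "Sh C X' \<in> smd C \<A>"
  proof induction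
    case (base X)
    show ?case by (rule smd.base[OF imageI[OF base, of "Sh C", unfolded Sh]])
  next
    case (summand S X Y)
    have "is_biproduct C (Sh C X) (Sh C Y) (Sh C S)"
      using is_biproduct_Sh_iff[OF is_biproductD(1-3)[OF summand(2)]] summand(2) by simp
    then show ?case by (rule smd.summand[OF summand.IH])
  qed
  then show "X \<in> smd C \<A>" using X by simp
next
  fix X assume "X \<in> smd C \<A>"
  then show "X \<in> Sh C ` smd C \<A>"
  proof induction
    case (base X)
    then have "X \<in> Sh C ` \<A>" by (simp only: Sh)
    then obtain X' where X': "X = Sh C X'" "X' \<in> \<A>" by (rule imageE)
    show ?case unfolding X'(1) by (intro imageI smd.base X'(2))
  next
    case (summand S X Y)
    note b = is_biproductD[OF summand(2)]
    obtain X' where X': "X' \<in> Obj C" "X = Sh C X'" using Sh_surj[OF b(1)] ..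
    obtain Y' where Y': "Y' \<in> Obj C" "Y = Sh C Y'" using Sh_surj[OF b(2)] ..
    obtain S' where S': "S = Sh C S'" "S' \<in> smd C \<A>" using summand.IH ..
    have "S' \<in> Obj C" using S'(2) smd_subset[OF \<A>] by (rule rev_subsetD)
    then have "is_biproduct C X' Y' S'"
      using is_biproduct_Sh_iff[OF X'(1) Y'(1)] summand(2) X'(2) Y'(2) S'(1) by simp
    then have "X' \<in> smd C \<A>" by (rule smd.summand[OF S'(2)])
    then show ?case using X'(2) by (rule rev_image_eqI)
  qed
qed

lemma Sh_image_ext_prod:
  assumes sub: "\<A> \<subseteq> Obj C" "\<B> \<subseteq> Obj C" and Sh: "Sh C ` \<A> = \<A>" "Sh C ` \<B> = \<B>"
  shows "Sh C ` ext_prod C \<A> \<B> = ext_prod C \<A> \<B>"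
proof (intro equalityI subsetI)
  fix Y assume "Y \<in> Sh C ` ext_prod C \<A> \<B>"
  then obtain X Y' Z f g h where "Y = Sh C Y'" "X \<in> \<A>" "Z \<in> \<B>" "(X, Y', Z, f, g, h) \<in> Tri C"
    unfolding ext_prod_def by blast
  moreover have "Sh C X \<in> \<A>" "Sh C Z \<in> \<B>" using Sh calculation(2,3) by blast+
  ultimately show "Y \<in> ext_prod C \<A> \<B>"
    unfolding ext_prod_def using triangle_Sh by blast
next
  fix Y assume "Y \<in> ext_prod C \<A> \<B>"
  then obtain X Z f g h where XZ: "X \<in> \<A>" "Z \<in> \<B>" and T: "(X, Y, Z, f, g, h) \<in> Tri C"
    unfolding ext_prod_def by blast
  obtain X' where X': "X' \<in> \<A>" "X = Sh C X'" using Sh XZ by blast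
  obtain Z' where Z': "Z' \<in> \<B>" "Z = Sh C Z'" using Sh XZ by blast
  obtain Y' where Y': "Y' \<in> Obj C" "Y = Sh C Y'" using Sh_surj triangleD(2)[OF T] by blast
  have "\<exists>f g h. (X', Y', Z', f, g, h) \<in> Tri C"
    using triangle_unSh[of X' Y' Z'] T X' Y' Z' sub by blast
  then show "Y \<in> Sh C ` ext_prod C \<A> \<B>"
    unfolding ext_prod_def using X' Y' Z' by blast
qed

lemma Sh_image_ext_pow:
  assumes "\<A> \<subseteq> Obj C" "Sh C ` \<A> = \<A>"
  shows "Sh C ` ext_pow C \<A> n = ext_pow C \<A> n"
proof (induction n rule: nat_less_induct)
  case (1 n)
  consider "n = 0" | "n = Suc 0" | m where "n = Suc (Suc m)" by (metis not0_implies_Suc)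
  then show ?case
  proof cases
    case 3
    then have "Sh C ` ext_pow C \<A> (Suc m) = ext_pow C \<A> (Suc m)" using 1 by blast
    moreover note Sh_image_smd[OF assms]
    ultimately show ?thesis
      using Sh_image_smd[OF ext_prod_subset Sh_image_ext_prod] ext_pow_subset[OF assms(1)]
        smd_subset[OF assms(1)] by (simp add: 3)
  qed (use Sh_image_smd[OF assms] in simp_all)
qed

end

section \<open>Covering a cohomological functor and killing its relations\<close>

locale cohomological_functor = triangulated_category R C + linear_functor R C M
  for R :: "('r, 'k) ring_scheme" and C :: "('r, 'o, 'm, 'c) tri_cat_scheme" (structure)
    and M :: "('r, 'o, 'm, 'v) cfunctor" +
  assumes exact: "(X, Y, Z, f, g, h) \<in> Tri C \<Longrightarrow>
    FMor M g ` carrier (FObj M Z) = {y \<in> carrier (FObj M Y). FMor M f y = \<zero>\<^bsub>FObj M X\<^esub>}"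
begin

lemma exact_comp_zero:
  "\<lbrakk>(X, Y, Z, f, g, h) \<in> Tri C; m \<in> val Z\<rbrakk> \<Longrightarrow> FMor M f (FMor M g m) = \<zero>\<^bsub>FObj M X\<^esub>"
  using exact by blast

lemma exact_lift:
  assumes "(X, Y, Z, f, g, h) \<in> Tri C" "m \<in> val Y" "FMor M f m = \<zero>\<^bsub>FObj M X\<^esub>"
  shows "\<exists>m' \<in> val Z. m = FMor M g m'"
  using exact[OF assms(1)] assms(2,3) by blast

definition covers :: "'o \<Rightarrow> 'v \<Rightarrow> 'o \<Rightarrow> bool"
  where "covers E e X \<longleftrightarrow> (\<forall>m \<in> val X. \<exists>x \<in> homs C X E. FMor M x e = m)"

definition kills :: "'o \<Rightarrow> 'v \<Rightarrow> 'o \<Rightarrow> 'm \<Rightarrow> 'o \<Rightarrow> bool"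
  where "kills E e E' t X \<longleftrightarrow>
    (\<forall>x \<in> homs C X E. FMor M x e = \<zero>\<^bsub>FObj M X\<^esub> \<longrightarrow> t \<cdot> x = \<zero>\<^bsub>Hom C X E'\<^esub>)"

definition refines :: "'o \<Rightarrow> 'v \<Rightarrow> 'o \<Rightarrow> 'v \<Rightarrow> 'm \<Rightarrow> bool"
  where "refines E e E' e' t \<longleftrightarrow> E \<in> Obj C \<and> E' \<in> Obj C \<and> e \<in> val E \<and> e' \<in> val E' \<and>
    t \<in> homs C E E' \<and> FMor M t e' = e"

text \<open>
  The starting pair is arbitrary, so that refinements for different classes can be composed.  It is
  asked to cover \<open>\<A>\<close> because cones are built only to kill: the objects of \<open>\<A>\<close> stay covered under
  refinement, and coverage of other objects is deduced from that.
\<close>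

definition controlled :: "'o set \<Rightarrow> 'o set \<Rightarrow> bool"
  where "controlled \<A> \<B> \<longleftrightarrow>
    (\<forall>E \<in> Obj C. \<forall>e \<in> val E. (\<forall>A \<in> \<A>. covers E e A) \<longrightarrow>
      (\<exists>E' e' t. refines E e E' e' t \<and> (\<forall>X \<in> \<B>. covers E' e' X \<and> kills E e E' t X)))"

lemma coversD: "\<lbrakk>covers E e X; m \<in> val X\<rbrakk> \<Longrightarrow> \<exists>x \<in> homs C X E. FMor M x e = m"
  unfolding covers_def by blast

lemma killsD:
  "\<lbrakk>kills E e E' t X; x \<in> homs C X E; FMor M x e = \<zero>\<^bsub>FObj M X\<^esub>\<rbrakk> \<Longrightarrow> t \<cdot> x = \<zero>\<^bsub>Hom C X E'\<^esub>"
  unfolding kills_def by blast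

lemma refinesD:
  assumes "refines E e E' e' t"
  shows "E \<in> Obj C" "E' \<in> Obj C" "e \<in> val E" "e' \<in> val E'" "t \<in> homs C E E'" "FMor M t e' = e"
  using assms unfolding refines_def by auto

lemma refines_act:
  assumes r: "refines E e E' e' t" and X: "X \<in> Obj C" "x \<in> homs C X E"
  shows "FMor M (t \<cdot> x) e' = FMor M x e"
  using act_Comp[OF X(1) refinesD(1,2)[OF r] X(2) refinesD(5,4)[OF r]] refinesD(6)[OF r] by simp

lemma refines_trans:
  assumes r: "refines E e E' e' t" and r': "refines E' e' E'' e'' t'"
  shows "refines E e E'' e'' (t' \<cdot> t)"
  using refines_act[OF r' refinesD(1,5)[OF r]] refinesD[OF r] refinesD[OF r']
    comp_closed[of E E' E'' t t']
  unfolding refines_def by simp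

lemma covers_refines:
  assumes r: "refines E e E' e' t" and X: "X \<in> Obj C" "covers E e X"
  shows "covers E' e' X"
  unfolding covers_def
proof
  fix m assume "m \<in> val X"
  then obtain x where x: "x \<in> homs C X E" "FMor M x e = m" using coversD X by blast
  have "t \<cdot> x \<in> homs C X E'" by (rule comp_closed[OF X(1) refinesD(1,2)[OF r] x(1) refinesD(5)[OF r]])
  then show "\<exists>x \<in> homs C X E'. FMor M x e' = m" using refines_act[OF r X(1) x(1)] x(2) by auto
qed

text \<open>
  The cone of the map onto the kernel is the refinement: \<open>e\<close> extends over it because \<open>M\<close> is
  exact, and every kernel element over \<open>\<A>\<close> factors through \<open>u\<close>, hence dies in the cone.
\<close>

lemma controlled_base:
  assumes sub: "\<A> \<subseteq> Obj C"
    and ker: "\<And>E e. \<lbrakk>E \<in> Obj C; e \<in> val E\<rbrakk> \<Longrightarrow>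
      \<exists>A \<in> \<A>. \<exists>u \<in> homs C A E. FMor M u e = \<zero>\<^bsub>FObj M A\<^esub> \<and>
        (\<forall>X \<in> \<A>. \<forall>x \<in> homs C X E. FMor M x e = \<zero>\<^bsub>FObj M X\<^esub> \<longrightarrow> (\<exists>y \<in> homs C X A. x = u \<cdot> y))"
  shows "controlled \<A> \<A>"
  unfolding controlled_def
proof (intro ballI impI)
  fix E e assume E: "E \<in> Obj C" "e \<in> val E" and cov: "\<forall>A \<in> \<A>. covers E e A"
  obtain A u where A: "A \<in> \<A>" and u: "u \<in> homs C A E" "FMor M u e = \<zero>\<^bsub>FObj M A\<^esub>"
    and ux: "\<And>X x. \<lbrakk>X \<in> \<A>; x \<in> homs C X E; FMor M x e = \<zero>\<^bsub>FObj M X\<^esub>\<rbrakk>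
      \<Longrightarrow> \<exists>y \<in> homs C X A. x = u \<cdot> y"
    using ker[OF E] by blast
  have AO: "A \<in> Obj C" using A sub by blast
  obtain E' t h where T: "(A, E, E', u, t, h) \<in> Tri C" using TR1_cone[OF AO E(1) u(1)] by blast
  note tt = triangleD[OF T]
  obtain e' where e': "e' \<in> val E'" "e = FMor M t e'" using exact_lift[OF T E(2) u(2)] by blast
  have r: "refines E e E' e' t" unfolding refines_def using tt e' E by simp
  have "covers E' e' X \<and> kills E e E' t X" if X: "X \<in> \<A>" for X
  proof
    have XO: "X \<in> Obj C" using X sub by blast
    show "covers E' e' X" using covers_refines[OF r XO] cov X by blast
    have "t \<cdot> (u \<cdot> y) = \<zero>\<^bsub>Hom C X E'\<^esub>" if y: "y \<in> homs C X A" for y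
      using Comp_assoc[OF XO AO E(1) tt(3) y u(1) tt(5)] triangle_comp_zero[OF T]
        comp_zero_left[OF XO AO tt(3) y] by simp
    then show "kills E e E' t X" unfolding kills_def using ux[OF X] by blast
  qed
  then show "\<exists>E' e' t. refines E e E' e' t \<and> (\<forall>X \<in> \<A>. covers E' e' X \<and> kills E e E' t X)"
    using r by blast
qed

text \<open>Both properties pass to retracts \<open>i : X \<rightarrow> S\<close>, \<open>p : S \<rightarrow> X\<close>: transport along \<open>p\<close>, return along \<open>i\<close>.\<close>

lemma covers_retract:
  assumes O: "E \<in> Obj C" "e \<in> val E" "X \<in> Obj C" "S \<in> Obj C"
    and ip: "i \<in> homs C X S" "p \<in> homs C S X" "p \<cdot> i = Id C X" and S: "covers E e S"
  shows "covers E e X"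
  unfolding covers_def
proof
  fix m assume m: "m \<in> val X"
  obtain s where s: "s \<in> homs C S E" "FMor M s e = FMor M p m"
    using coversD[OF S act_closed[OF O(4,3) ip(2) m]] by blast
  have "FMor M (s \<cdot> i) e = FMor M i (FMor M p m)"
    using act_Comp[OF O(3,4,1) ip(1) s(1) O(2)] s(2) by simp
  also have "\<dots> = m" using act_Comp[OF O(3,4,3) ip(1,2) m] ip(3) act_Id[OF O(3) m] by simp
  finally show "\<exists>x \<in> homs C X E. FMor M x e = m"
    using comp_closed[OF O(3,4,1) ip(1) s(1)] by blast
qed

lemma kills_retract:
  assumes r: "refines E e E' e' t" and O: "X \<in> Obj C" "S \<in> Obj C"
    and ip: "i \<in> homs C X S" "p \<in> homs C S X" "p \<cdot> i = Id C X" and S: "kills E e E' t S"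
  shows "kills E e E' t X"
  unfolding kills_def
proof (intro ballI impI)
  note rr = refinesD[OF r]
  fix x assume x: "x \<in> homs C X E" "FMor M x e = \<zero>\<^bsub>FObj M X\<^esub>"
  have xp: "x \<cdot> p \<in> homs C S E" by (rule comp_closed[OF O(2,1) rr(1) ip(2) x(1)])
  have "FMor M (x \<cdot> p) e = \<zero>\<^bsub>FObj M S\<^esub>"
    using act_Comp[OF O(2,1) rr(1) ip(2) x(1) rr(3)] x(2) act_zero[OF O(2,1) ip(2)] by simp
  then have "t \<cdot> (x \<cdot> p) = \<zero>\<^bsub>Hom C S E'\<^esub>" by (rule killsD[OF S xp])
  then have "(t \<cdot> (x \<cdot> p)) \<cdot> i = \<zero>\<^bsub>Hom C X E'\<^esub>" using comp_zero_left[OF O rr(2) ip(1)] by simp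
  also have "(t \<cdot> (x \<cdot> p)) \<cdot> i = t \<cdot> x"
    using Comp_assoc[OF O rr(1,2) ip(1) xp rr(5)] Comp_assoc[OF O(1,2,1) rr(1) ip(1,2) x(1)]
      ip(3) Id_right[OF O(1) rr(1) x(1)] by simp
  finally show "t \<cdot> x = \<zero>\<^bsub>Hom C X E'\<^esub>" .
qed

lemma controlled_smd:
  assumes sub: "\<B> \<subseteq> Obj C" and c: "controlled \<A> \<B>"
  shows "controlled \<A> (smd C \<B>)"
  unfolding controlled_def
proof (intro ballI impI)
  fix E e assume "E \<in> Obj C" "e \<in> val E" "\<forall>A \<in> \<A>. covers E e A"
  then obtain E' e' t where r: "refines E e E' e' t"
    and ck: "\<forall>X \<in> \<B>. covers E' e' X \<and> kills E e E' t X"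
    using c unfolding controlled_def by meson
  have "covers E' e' X \<and> kills E e E' t X" if "X \<in> smd C \<B>" for X
    using that
  proof induction
    case (base X)
    then show ?case using ck by blast
  next
    case (summand S X Y)
    note b = is_biproductD[OF summand(2)]
    obtain i p where ip: "i \<in> homs C X S" "p \<in> homs C S X" "p \<cdot> i = Id C X" using b(4) by blast
    show ?case
      using covers_retract[OF refinesD(2,4)[OF r] b(1,3) ip] kills_retract[OF r b(1,3) ip]
        summand.IH by blast
  qed
  then show "\<exists>E' e' t. refines E e E' e' t \<and>
      (\<forall>X \<in> smd C \<B>. covers E' e' X \<and> kills E e E' t X)"
    using r by blast
qed

text \<open>
  Let \<open>y : Y \<rightarrow> E\<close> be in the kernel.  Its restriction to \<open>X\<close> dies under \<open>t1\<close>, so \<open>t1 \<cdot> y = z \<cdot> g\<close>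
  for some \<open>z : Z \<rightarrow> E1\<close>.  This \<open>z\<close> need not be in the kernel, but the element it defines vanishes
  on \<open>Y\<close>, so it comes from \<open>M(X[1])\<close>.  As \<open>X[1]\<close> is covered, \<open>z\<close> can be corrected by some
  \<open>x \<cdot> h\<close>, which does not change \<open>z \<cdot> g\<close> since \<open>h \<cdot> g = 0\<close>.  The corrected map dies under \<open>t2\<close>.
\<close>

lemma kills_extension:
  assumes T: "(X, Y, Z, f, g, h) \<in> Tri C"
    and r1: "refines E e E1 e1 t1" and r2: "refines E1 e1 E2 e2 t2"
    and X: "kills E e E1 t1 X" and ShX: "covers E1 e1 (Sh C X)" and Z: "kills E1 e1 E2 t2 Z"
  shows "kills E e E2 (t2 \<cdot> t1) Y"
  unfolding kills_def
proof (intro ballI impI)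
  note t = triangleD[OF T] and rr1 = refinesD[OF r1] and rr2 = refinesD[OF r2]
  note T' = triangle_rotate[OF T]
  have ShXO: "Sh C X \<in> Obj C" using t Sh_obj by simp
  fix y assume y: "y \<in> homs C Y E" "FMor M y e = \<zero>\<^bsub>FObj M Y\<^esub>"
  have yf: "y \<cdot> f \<in> homs C X E" by (rule comp_closed[OF t(1,2) rr1(1) t(4) y(1)])
  have t1y: "t1 \<cdot> y \<in> homs C Y E1" by (rule comp_closed[OF t(2) rr1(1,2) y(1) rr1(5)])
  have "FMor M (y \<cdot> f) e = \<zero>\<^bsub>FObj M X\<^esub>"
    using act_Comp[OF t(1,2) rr1(1) t(4) y(1) rr1(3)] y(2) act_zero[OF t(1,2,4)] by simp
  then have "(t1 \<cdot> y) \<cdot> f = \<zero>\<^bsub>Hom C X E1\<^esub>"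
    using killsD[OF X yf] Comp_assoc[OF t(1,2) rr1(1,2) t(4) y(1) rr1(5)] by simp
  then obtain z where z: "z \<in> homs C Z E1" "t1 \<cdot> y = z \<cdot> g"
    using triangle_extend[OF T rr1(2) t1y] by blast
  have zM: "FMor M z e1 \<in> val Z" by (rule act_closed[OF t(3) rr1(2) z(1) rr1(4)])
  have "FMor M g (FMor M z e1) = \<zero>\<^bsub>FObj M Y\<^esub>"
    using act_Comp[OF t(2,3) rr1(2) t(5) z(1) rr1(4)] refines_act[OF r1 t(2) y(1)] y(2) z(2) by simp
  then obtain m where m: "m \<in> val (Sh C X)" "FMor M z e1 = FMor M h m"
    using exact_lift[OF T' zM] by blast
  obtain x where x: "x \<in> homs C (Sh C X) E1" "FMor M x e1 = m" using coversD[OF ShX m(1)] by blast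
  have xh: "x \<cdot> h \<in> homs C Z E1" by (rule comp_closed[OF t(3) ShXO rr1(2) t(6) x(1)])
  have "FMor M (x \<cdot> h) e1 = FMor M z e1"
    using act_Comp[OF t(3) ShXO rr1(2) t(6) x(1) rr1(4)] x(2) m(2) by simp
  then have "FMor M (z \<ominus>\<^bsub>Hom C Z E1\<^esub> (x \<cdot> h)) e1 = \<zero>\<^bsub>FObj M Z\<^esub>"
    using eval_diff[OF t(3) rr1(2,4) z(1) xh] val_diff_eq_zero_iff[OF t(3) zM zM] by simp
  then have "t2 \<cdot> (z \<ominus>\<^bsub>Hom C Z E1\<^esub> (x \<cdot> h)) = \<zero>\<^bsub>Hom C Z E2\<^esub>"
    by (rule killsD[OF Z diff_closed[OF t(3) rr1(2) z(1) xh]])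
  then have t2z: "t2 \<cdot> z = t2 \<cdot> (x \<cdot> h)"
    using comp_diff_right[OF t(3) rr2(1,2) z(1) xh rr2(5)]
      diff_eq_zero_iff[OF t(3) rr2(2) comp_closed[OF t(3) rr2(1,2) z(1) rr2(5)]
        comp_closed[OF t(3) rr2(1,2) xh rr2(5)]] by simp
  have "(t2 \<cdot> t1) \<cdot> y = t2 \<cdot> (z \<cdot> g)"
    using Comp_assoc[OF t(2) rr1(1) rr2(1,2) y(1) rr1(5) rr2(5)] z(2) by simp
  also have "\<dots> = (t2 \<cdot> (x \<cdot> h)) \<cdot> g"
    using Comp_assoc[OF t(2,3) rr2(1,2) t(5) z(1) rr2(5)] t2z by simp
  also have "\<dots> = t2 \<cdot> (x \<cdot> (h \<cdot> g))"
    using Comp_assoc[OF t(2,3) rr2(1,2) t(5) xh rr2(5)]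
      Comp_assoc[OF t(2,3) ShXO rr2(1) t(5,6) x(1)] by simp
  also have "\<dots> = \<zero>\<^bsub>Hom C Y E2\<^esub>"
    using triangle_comp_zero[OF T'] comp_zero_right[OF t(2) ShXO rr2(1) x(1)]
      comp_zero_right[OF t(2) rr2(1,2,5)] by simp
  finally show "(t2 \<cdot> t1) \<cdot> y = \<zero>\<^bsub>Hom C Y E2\<^esub>" .
qed

text \<open>
  Let \<open>m \<in> M(Y)\<close>.  Its restriction to \<open>X\<close> comes from some \<open>x : X \<rightarrow> E1\<close>.  The obstruction to extending
  \<open>x\<close> to \<open>Y\<close> is a kernel element at \<open>Z' = Z[-1]\<close>, so it vanishes after composition with \<open>t\<close>.  An
  extension \<open>y\<close> of \<open>t \<cdot> x\<close> realises \<open>m\<close> up to an element that comes from \<open>M(Z)\<close>, and \<open>Z\<close> is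
  covered.
\<close>

lemma covers_extension:
  assumes T: "(X, Y, Z, f, g, h) \<in> Tri C" and r: "refines E1 e1 E2 e2 t"
    and X: "covers E1 e1 X" and Z: "covers E2 e2 Z"
    and Z': "Z' \<in> Obj C" "Z = Sh C Z'" "kills E1 e1 E2 t Z'"
  shows "covers E2 e2 Y"
  unfolding covers_def
proof
  note tt = triangleD[OF T] and rr = refinesD[OF r]
  fix m assume m: "m \<in> val Y"
  have fm: "FMor M f m \<in> val X" by (rule act_closed[OF tt(1,2,4) m])
  obtain x where x: "x \<in> homs C X E1" "FMor M x e1 = FMor M f m" using coversD[OF X fm] by blast
  obtain u where T': "(Z', X, Y, u, f, g) \<in> Tri C" using triangle_rotate_back[OF T Z'(1,2)] by blast
  note u = triangleD(4)[OF T']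
  have xu: "x \<cdot> u \<in> homs C Z' E1" by (rule comp_closed[OF Z'(1) tt(1) rr(1) u x(1)])
  have "FMor M (x \<cdot> u) e1 = \<zero>\<^bsub>FObj M Z'\<^esub>"
    using act_Comp[OF Z'(1) tt(1) rr(1) u x(1) rr(3)] x(2) exact_comp_zero[OF T' m] by simp
  then have "t \<cdot> (x \<cdot> u) = \<zero>\<^bsub>Hom C Z' E2\<^esub>" by (rule killsD[OF Z'(3) xu])
  then have "(t \<cdot> x) \<cdot> u = \<zero>\<^bsub>Hom C Z' E2\<^esub>"
    using Comp_assoc[OF Z'(1) tt(1) rr(1,2) u x(1) rr(5)] by simp
  then obtain y where y: "y \<in> homs C Y E2" "t \<cdot> x = y \<cdot> f"
    using triangle_extend[OF T' rr(2) comp_closed[OF tt(1) rr(1,2) x(1) rr(5)]] by blast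
  have ye: "FMor M y e2 \<in> val Y" by (rule act_closed[OF tt(2) rr(2) y(1) rr(4)])
  have "FMor M f (FMor M y e2) = FMor M f m"
    using act_Comp[OF tt(1,2) rr(2) tt(4) y(1) rr(4)] refines_act[OF r tt(1) x(1)] x(2) y(2) by simp
  then have "FMor M f (m \<ominus>\<^bsub>FObj M Y\<^esub> FMor M y e2) = \<zero>\<^bsub>FObj M X\<^esub>"
    using act_diff[OF tt(1,2,4) m ye] val_diff_eq_zero_iff[OF tt(1) fm fm] by simp
  then obtain m' where m': "m' \<in> val Z" "m \<ominus>\<^bsub>FObj M Y\<^esub> FMor M y e2 = FMor M g m'"
    using exact_lift[OF T val_diff_closed[OF tt(2) m ye]] by blast
  obtain z where z: "z \<in> homs C Z E2" "FMor M z e2 = m'" using coversD[OF Z m'(1)] by blast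
  have zg: "z \<cdot> g \<in> homs C Y E2" by (rule comp_closed[OF tt(2,3) rr(2) tt(5) z(1)])
  interpret MY: abelian_group "FObj M Y" by (rule val_group[OF tt(2)])
  have "FMor M (y \<oplus>\<^bsub>Hom C Y E2\<^esub> (z \<cdot> g)) e2
      = FMor M y e2 \<oplus>\<^bsub>FObj M Y\<^esub> (m \<ominus>\<^bsub>FObj M Y\<^esub> FMor M y e2)"
    using eval_add[OF tt(2) rr(2,4) y(1) zg] act_Comp[OF tt(2,3) rr(2) tt(5) z(1) rr(4)] z(2) m'(2)
    by simp
  also have "\<dots> = m" using m ye by (simp add: a_minus_def MY.a_lcomm MY.r_neg)
  finally show "\<exists>x \<in> homs C Y E2. FMor M x e2 = m"
    using add_closed[OF tt(2) rr(2) y(1) zg] by blast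
qed

lemma controlled_ext_prod:
  assumes sub: "\<A> \<subseteq> Obj C" "\<B> \<subseteq> Obj C" "\<Z> \<subseteq> Obj C"
    and Sh: "Sh C ` \<B> = \<B>" "Sh C ` \<Z> = \<Z>"
    and c: "controlled \<A> \<B>" "controlled \<A> \<Z>"
  shows "controlled \<A> (ext_prod C \<B> \<Z>)"
  unfolding controlled_def
proof (intro ballI impI)
  fix E e assume "E \<in> Obj C" "e \<in> val E" and cov: "\<forall>A \<in> \<A>. covers E e A"
  then obtain E1 e1 t1 where r1: "refines E e E1 e1 t1"
    and ck1: "\<And>X. X \<in> \<B> \<Longrightarrow> covers E1 e1 X \<and> kills E e E1 t1 X"
    using c(1) unfolding controlled_def by meson
  have "\<forall>A \<in> \<A>. covers E1 e1 A" using covers_refines[OF r1] cov sub(1) by blast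
  then obtain E2 e2 t2 where r2: "refines E1 e1 E2 e2 t2"
    and ck2: "\<And>X. X \<in> \<Z> \<Longrightarrow> covers E2 e2 X \<and> kills E1 e1 E2 t2 X"
    using c(2) refinesD(2,4)[OF r1] unfolding controlled_def by meson
  have "covers E2 e2 Y \<and> kills E e E2 (t2 \<cdot> t1) Y" if Y: "Y \<in> ext_prod C \<B> \<Z>" for Y
  proof -
    obtain X Z f g h where XZ: "X \<in> \<B>" "Z \<in> \<Z>" and T: "(X, Y, Z, f, g, h) \<in> Tri C"
      using Y unfolding ext_prod_def by blast
    obtain Z' where Z': "Z' \<in> \<Z>" "Z = Sh C Z'" using Sh(2) XZ(2) by blast
    have "Sh C X \<in> \<B>" using Sh(1) XZ(1) by blast
    then show ?thesis
      using kills_extension[OF T r1 r2] covers_extension[OF T r2] XZ Z' sub(3) ck1 ck2 by blast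
  qed
  then show "\<exists>E' e' t. refines E e E' e' t \<and>
      (\<forall>X \<in> ext_prod C \<B> \<Z>. covers E' e' X \<and> kills E e E' t X)"
    using refines_trans[OF r1 r2] by blast
qed

lemma controlled_ext_pow:
  assumes sub: "\<A> \<subseteq> Obj C" and Sh: "Sh C ` \<A> = \<A>" and c: "controlled \<A> \<A>"
  shows "controlled \<A> (ext_pow C \<A> (Suc n))"
proof (induction n)
  case 0
  then show ?case using controlled_smd[OF sub c] by simp
next
  case (Suc n)
  have "controlled \<A> (ext_prod C (ext_pow C \<A> (Suc n)) (ext_pow C \<A> (Suc 0)))"
    using controlled_ext_prod[OF sub ext_pow_subset[OF sub] ext_pow_subset[OF sub]
        Sh_image_ext_pow[OF sub Sh] Sh_image_ext_pow[OF sub Sh] Suc, of "Suc 0"]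
      controlled_smd[OF sub c]
    by simp
  then show ?case using controlled_smd[OF ext_prod_subset] by simp
qed

end

section \<open>Splitting off the functor from a representable one\<close>

context cohomological_functor
begin

text \<open>
  The element \<open>e\<close> presents \<open>M\<close> as a quotient of \<open>Hom(-, E)\<close>, and \<open>s\<close> is an endomorphism over \<open>M\<close>
  that annihilates the kernel.  Composition with \<open>s\<close> is then an idempotent of \<open>Hom(-, E)\<close> whose
  image is a copy of \<open>M\<close>.
\<close>

definition projector :: "'o \<Rightarrow> 'v \<Rightarrow> 'm \<Rightarrow> bool"
  where "projector E e s \<longleftrightarrow> refines E e E e s \<and> (\<forall>X \<in> Obj C. covers E e X \<and> kills E e E s X)"

text \<open>
  Refine twice, to \<open>t2 : E1 \<rightarrow> E2\<close>.  Covering \<open>E2\<close> by \<open>E1\<close> lifts \<open>e2\<close> itself to some \<open>x : E2 \<rightarrow> E1\<close>.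
  Then \<open>t2 \<cdot> x\<close> is a map over \<open>M\<close>, and it kills because \<open>x\<close> sends kernels to kernels, where \<open>t2\<close>
  vanishes.
\<close>

lemma ex_projector:
  assumes c: "controlled \<A> (Obj C)" and sub: "\<A> \<subseteq> Obj C"
    and E: "E \<in> Obj C" "e \<in> val E" "\<forall>A \<in> \<A>. covers E e A"
  shows "\<exists>E e s. projector E e s"
proof -
  obtain E1 e1 t1 where r1: "refines E e E1 e1 t1" and c1: "\<And>X. X \<in> Obj C \<Longrightarrow> covers E1 e1 X"
    using c E unfolding controlled_def by meson
  have "\<forall>A \<in> \<A>. covers E1 e1 A" using c1 sub by blast
  then obtain E2 e2 t2 where r2: "refines E1 e1 E2 e2 t2"
    and ck2: "\<And>X. X \<in> Obj C \<Longrightarrow> covers E2 e2 X \<and> kills E1 e1 E2 t2 X"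
    using c refinesD(2,4)[OF r1] unfolding controlled_def by meson
  note rr = refinesD[OF r2]
  obtain x where x: "x \<in> homs C E2 E1" "FMor M x e1 = e2" using coversD[OF c1[OF rr(2)] rr(4)] by blast
  have "FMor M (t2 \<cdot> x) e2 = e2" using refines_act[OF r2 rr(2) x(1)] x(2) by simp
  then have "refines E2 e2 E2 e2 (t2 \<cdot> x)"
    unfolding refines_def using rr comp_closed[OF rr(2,1,2) x(1) rr(5)] by simp
  moreover have "kills E2 e2 E2 (t2 \<cdot> x) X" if X: "X \<in> Obj C" for X
    unfolding kills_def
  proof (intro ballI impI)
    fix y assume y: "y \<in> homs C X E2" "FMor M y e2 = \<zero>\<^bsub>FObj M X\<^esub>"
    have "FMor M (x \<cdot> y) e1 = \<zero>\<^bsub>FObj M X\<^esub>"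
      using act_Comp[OF X rr(2,1) y(1) x(1) rr(3)] x(2) y(2) by simp
    then have "t2 \<cdot> (x \<cdot> y) = \<zero>\<^bsub>Hom C X E2\<^esub>"
      using killsD[of E1 e1 E2 t2 X] ck2[OF X] comp_closed[OF X rr(2,1) y(1) x(1)] by simp
    then show "(t2 \<cdot> x) \<cdot> y = \<zero>\<^bsub>Hom C X E2\<^esub>"
      using Comp_assoc[OF X rr(2,1,2) y(1) x(1) rr(5)] by simp
  qed
  ultimately show ?thesis unfolding projector_def using ck2 by blast
qed

text \<open>
  Both \<open>s\<close> and the identity fix \<open>e\<close>, so their difference is in the kernel at \<open>E\<close>, where
  \<open>s\<close> vanishes.
\<close>

lemma projector_idem:
  assumes "projector E e s"
  shows "s \<cdot> s = s"
proof -
  have r: "refines E e E e s" and k: "kills E e E s E"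
    using assms unfolding projector_def refines_def by auto
  note rr = refinesD[OF r]
  note Id = Id_closed[OF rr(1)]
  have "FMor M (s \<ominus>\<^bsub>Hom C E E\<^esub> Id C E) e = \<zero>\<^bsub>FObj M E\<^esub>"
    using eval_diff[OF rr(1,1,3,5) Id] rr(6) act_Id[OF rr(1,3)] val_diff_eq_zero_iff[OF rr(1,3,3)]
    by simp
  then have "s \<cdot> (s \<ominus>\<^bsub>Hom C E E\<^esub> Id C E) = \<zero>\<^bsub>Hom C E E\<^esub>"
    by (rule killsD[OF k diff_closed[OF rr(1,1,5) Id]])
  then have "s \<cdot> s = s \<cdot> Id C E"
    using comp_diff_right[OF rr(1,1,1,5) Id rr(5)]
      diff_eq_zero_iff[OF rr(1,1) comp_closed[OF rr(1,1,1,5,5)] comp_closed[OF rr(1,1,1) Id rr(5)]]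
    by simp
  then show ?thesis using Id_right[OF rr(1,1,5)] by simp
qed

text \<open>
  A map out of \<open>Hom(-, E)\<close> that annihilates the kernel of the surjection onto \<open>M\<close> factors through
  \<open>M\<close>.
\<close>

lemma nat_trans_from_kills:
  assumes E: "E \<in> Obj C" "e \<in> val E" and W: "W \<in> Obj C" "w \<in> homs C E W"
    and ck: "\<And>X. X \<in> Obj C \<Longrightarrow> covers E e X \<and> kills E e W w X"
  shows "\<exists>\<beta>. nat_trans R C M (hom_functor C W) \<beta> \<and>
    (\<forall>X \<in> Obj C. \<forall>x \<in> homs C X E. \<beta> X (FMor M x e) = w \<cdot> x)"
proof -
  have "\<exists>y. \<forall>x \<in> homs C X E. FMor M x e = m \<longrightarrow> y = w \<cdot> x" if X: "X \<in> Obj C" for X m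
  proof (intro exI ballI impI)
    let ?x0 = "SOME x. x \<in> homs C X E \<and> FMor M x e = m"
    fix x assume x: "x \<in> homs C X E" "FMor M x e = m"
    then have x0: "?x0 \<in> homs C X E" "FMor M ?x0 e = m"
      using someI[of "\<lambda>x. x \<in> homs C X E \<and> FMor M x e = m" x] by auto
    have xM: "FMor M x e \<in> val X" by (rule act_closed[OF X E(1) x(1) E(2)])
    have "FMor M (?x0 \<ominus>\<^bsub>Hom C X E\<^esub> x) e = \<zero>\<^bsub>FObj M X\<^esub>"
      using eval_diff[OF X E x0(1) x(1)] x(2) x0(2) val_diff_eq_zero_iff[OF X xM xM] by simp
    then have "w \<cdot> (?x0 \<ominus>\<^bsub>Hom C X E\<^esub> x) = \<zero>\<^bsub>Hom C X W\<^esub>"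
      using killsD[of E e W w X] ck[OF X] diff_closed[OF X E(1) x0(1) x(1)] by blast
    then show "w \<cdot> ?x0 = w \<cdot> x"
      using comp_diff_right[OF X E(1) W(1) x0(1) x(1) W(2)]
        diff_eq_zero_iff[OF X W(1) comp_closed[OF X E(1) W(1) x0(1) W(2)]
          comp_closed[OF X E(1) W(1) x(1) W(2)]] by simp
  qed
  then obtain \<beta> where \<beta>: "\<And>X x m. \<lbrakk>X \<in> Obj C; x \<in> homs C X E; FMor M x e = m\<rbrakk> \<Longrightarrow> \<beta> X m = w \<cdot> x"
    by metis
  have lift: "\<exists>x \<in> homs C X E. FMor M x e = m" if "X \<in> Obj C" "m \<in> val X" for X m
    using coversD ck that by blast
  have "\<beta> X \<in> mod_hom R (FObj M X) (Hom C X W)" if X: "X \<in> Obj C" for X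
    unfolding mod_hom_def
  proof (safe)
    fix m assume "m \<in> val X"
    then obtain x where x: "x \<in> homs C X E" "FMor M x e = m" using lift X by blast
    show "\<beta> X m \<in> homs C X W" using \<beta>[OF X x] comp_closed[OF X E(1) W(1) x(1) W(2)] by simp
  next
    fix m m' assume "m \<in> val X" "m' \<in> val X"
    then obtain x x' where x: "x \<in> homs C X E" "FMor M x e = m"
      and x': "x' \<in> homs C X E" "FMor M x' e = m'" using lift X by meson
    have "FMor M (x \<oplus>\<^bsub>Hom C X E\<^esub> x') e = m \<oplus>\<^bsub>FObj M X\<^esub> m'"
      using eval_add[OF X E x(1) x'(1)] x(2) x'(2) by simp
    then have "\<beta> X (m \<oplus>\<^bsub>FObj M X\<^esub> m') = w \<cdot> (x \<oplus>\<^bsub>Hom C X E\<^esub> x')"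
      by (rule \<beta>[OF X add_closed[OF X E(1) x(1) x'(1)]])
    then show "\<beta> X (m \<oplus>\<^bsub>FObj M X\<^esub> m') = \<beta> X m \<oplus>\<^bsub>Hom C X W\<^esub> \<beta> X m'"
      using comp_add_right[OF X E(1) W x(1) x'(1)] \<beta>[OF X x] \<beta>[OF X x'] by simp
  next
    fix a m assume a: "a \<in> carrier R" and "m \<in> val X"
    then obtain x where x: "x \<in> homs C X E" "FMor M x e = m" using lift X by blast
    have ax: "a \<odot>\<^bsub>Hom C X E\<^esub> x \<in> homs C X E"
      using Hom_module[OF X E(1)] a x(1) by (rule module.smult_closed)
    have "FMor M (a \<odot>\<^bsub>Hom C X E\<^esub> x) e = a \<odot>\<^bsub>FObj M X\<^esub> m"
      using mod_hom_smult[OF eval_mod_hom[OF X E] a x(1)] x(2) by simp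
    then have "\<beta> X (a \<odot>\<^bsub>FObj M X\<^esub> m) = w \<cdot> (a \<odot>\<^bsub>Hom C X E\<^esub> x)" by (rule \<beta>[OF X ax])
    then show "\<beta> X (a \<odot>\<^bsub>FObj M X\<^esub> m) = a \<odot>\<^bsub>Hom C X W\<^esub> \<beta> X m"
      using comp_smult_right[OF X E(1) W a x(1)] \<beta>[OF X x] by simp
  qed
  moreover have "\<beta> X (FMor M f m) = \<beta> Y m \<cdot> f"
    if X: "X \<in> Obj C" and Y: "Y \<in> Obj C" and f: "f \<in> homs C X Y" and m: "m \<in> val Y" for X Y f m
  proof -
    obtain y where y: "y \<in> homs C Y E" "FMor M y e = m" using lift Y m by blast
    have "FMor M (y \<cdot> f) e = FMor M f m" using act_Comp[OF X Y E(1) f y(1) E(2)] y(2) by simp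
    then have "\<beta> X (FMor M f m) = w \<cdot> (y \<cdot> f)" by (rule \<beta>[OF X comp_closed[OF X Y E(1) f y(1)]])
    then show ?thesis using Comp_assoc[OF X Y E(1) W(1) f y(1) W(2)] \<beta>[OF Y y] by simp
  qed
  ultimately have "nat_trans R C M (hom_functor C W) \<beta>"
    unfolding nat_trans_def hom_functor_def by simp
  then show ?thesis using \<beta> by blast
qed

text \<open>
  The factorization \<open>s = v \<cdot> w\<close> through \<open>W\<close> is general enough for two uses: \<open>W = E\<close> with
  \<open>v = w = s\<close> gives the direct summand, and a splitting of \<open>s\<close> gives representability.  The inverse
  of \<open>\<beta>\<close> sends \<open>y\<close> to the element that \<open>v \<cdot> y\<close> defines.
\<close>

lemma projector_iso:
  assumes p: "projector E e s" and W: "W \<in> Obj C"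
    and wv: "w \<in> homs C E W" "v \<in> homs C W E" "v \<cdot> w = s" "w \<cdot> s = w"
  shows "\<exists>\<beta>. nat_trans R C M (hom_functor C W) \<beta> \<and>
    (\<forall>X \<in> Obj C. bij_betw (\<beta> X) (val X) {y \<in> homs C X W. w \<cdot> (v \<cdot> y) = y})"
proof -
  have r: "refines E e E e s" and ck: "\<And>X. X \<in> Obj C \<Longrightarrow> covers E e X \<and> kills E e E s X"
    using p unfolding projector_def by auto
  note rr = refinesD[OF r]
  have ws: "w \<cdot> (s \<cdot> x) = w \<cdot> x" if "X \<in> Obj C" "x \<in> homs C X E" for X x
    using Comp_assoc[OF that(1) rr(1,1) W that(2) rr(5) wv(1)] wv(4) by simp
  have vw: "v \<cdot> (w \<cdot> x) = s \<cdot> x" if "X \<in> Obj C" "x \<in> homs C X E" for X x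
    using Comp_assoc[OF that(1) rr(1) W rr(1) that(2) wv(1,2)] wv(3) by simp
  have "kills E e W w X" if X: "X \<in> Obj C" for X
    unfolding kills_def
  proof (intro ballI impI)
    fix x assume x: "x \<in> homs C X E" "FMor M x e = \<zero>\<^bsub>FObj M X\<^esub>"
    then have "s \<cdot> x = \<zero>\<^bsub>Hom C X E\<^esub>" using killsD ck[OF X] by blast
    then show "w \<cdot> x = \<zero>\<^bsub>Hom C X W\<^esub>" using ws[OF X x(1)] comp_zero_right[OF X rr(1) W wv(1)] by simp
  qed
  then obtain \<beta> where nt: "nat_trans R C M (hom_functor C W) \<beta>"
    and \<beta>: "\<And>X x. \<lbrakk>X \<in> Obj C; x \<in> homs C X E\<rbrakk> \<Longrightarrow> \<beta> X (FMor M x e) = w \<cdot> x"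
    using nat_trans_from_kills[OF rr(1,3) W wv(1)] ck by blast
  have "bij_betw (\<beta> X) (val X) {y \<in> homs C X W. w \<cdot> (v \<cdot> y) = y}" if X: "X \<in> Obj C" for X
  proof (rule bij_betw_byWitness[where f' = "\<lambda>y. FMor M (v \<cdot> y) e"])
    have \<beta>val: "FMor M (v \<cdot> \<beta> X m) e = m \<and> \<beta> X m \<in> homs C X W \<and> w \<cdot> (v \<cdot> \<beta> X m) = \<beta> X m"
      if m: "m \<in> val X" for m
    proof -
      obtain x where x: "x \<in> homs C X E" "FMor M x e = m" using coversD ck[OF X] m by blast
      have \<beta>m: "\<beta> X m = w \<cdot> x" using \<beta>[OF X x(1)] x(2) by simp
      show ?thesis
        using refines_act[OF r X x(1)] vw[OF X x(1)] ws[OF X x(1)] x(2)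
          comp_closed[OF X rr(1) W x(1) wv(1)] by (simp add: \<beta>m)
    qed
    then show "\<forall>m \<in> val X. FMor M (v \<cdot> \<beta> X m) e = m"
      and "\<beta> X ` val X \<subseteq> {y \<in> homs C X W. w \<cdot> (v \<cdot> y) = y}" by auto
    have "v \<cdot> y \<in> homs C X E" if "y \<in> homs C X W" for y
      by (rule comp_closed[OF X W rr(1) that wv(2)])
    then show "\<forall>y \<in> {y \<in> homs C X W. w \<cdot> (v \<cdot> y) = y}. \<beta> X (FMor M (v \<cdot> y) e) = y"
      and "(\<lambda>y. FMor M (v \<cdot> y) e) ` {y \<in> homs C X W. w \<cdot> (v \<cdot> y) = y} \<subseteq> val X"
      using \<beta>[OF X] act_closed[OF X rr(1) _ rr(3)] by auto
  qed
  then show ?thesis using nt by blast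
qed

end

context linear_category
begin

lemma subfunctor_hom_equalizer:
  assumes E: "E \<in> Obj C" and s: "s \<in> homs C E E" "s' \<in> homs C E E"
  shows "subfunctor R C (hom_functor C E) (\<lambda>X. {x \<in> homs C X E. s \<cdot> x = s' \<cdot> x})"
  unfolding subfunctor_def hom_functor_def cfunctor.simps
proof (intro conjI ballI)
  fix X assume X: "X \<in> Obj C"
  have s: "(\<lambda>x. s \<cdot> x) \<in> mod_hom R (Hom C X E) (Hom C X E)"
    "(\<lambda>x. s' \<cdot> x) \<in> mod_hom R (Hom C X E) (Hom C X E)"
    using Comp_linear_right[OF X E E] s by auto
  note m = Hom_module[OF X E]
  interpret module R "Hom C X E" by (rule m)
  show "submodule {x \<in> homs C X E. s \<cdot> x = s' \<cdot> x} R (Hom C X E)"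
    by (rule submoduleI)
      (auto simp: mod_hom_zero[OF m m s(1)] mod_hom_zero[OF m m s(2)]
        mod_hom_neg[OF m m s(1)] mod_hom_neg[OF m m s(2)] mod_hom_add[OF s(1)] mod_hom_add[OF s(2)]
        mod_hom_smult[OF s(1)] mod_hom_smult[OF s(2)])
next
  fix X Y f assume X: "X \<in> Obj C" and Y: "Y \<in> Obj C" and f: "f \<in> homs C X Y"
  show "(\<lambda>x. x \<cdot> f) ` {x \<in> homs C Y E. s \<cdot> x = s' \<cdot> x} \<subseteq> {x \<in> homs C X E. s \<cdot> x = s' \<cdot> x}"
  proof safe
    fix x assume x: "x \<in> homs C Y E" "s \<cdot> x = s' \<cdot> x"
    show "x \<cdot> f \<in> homs C X E" by (rule comp_closed[OF X Y E f x(1)])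
    show "s \<cdot> (x \<cdot> f) = s' \<cdot> (x \<cdot> f)"
      using Comp_assoc[OF X Y E E f x(1)] s x(2) by metis
  qed
qed

end

context cohomological_functor
begin

lemma projector_direct_summand:
  assumes p: "projector E e s"
  shows "iso_to_direct_summand R C M (hom_functor C E)"
proof -
  \<comment> \<open>Image and kernel of \<open>s\<close>, both written as equalizers: one lemma makes them subfunctors.\<close>
  let ?S = "\<lambda>X. {x \<in> homs C X E. s \<cdot> x = Id C E \<cdot> x}"
  let ?T = "\<lambda>X. {x \<in> homs C X E. s \<cdot> x = \<zero>\<^bsub>Hom C E E\<^esub> \<cdot> x}"
  have r: "refines E e E e s" using p unfolding projector_def by auto
  note E = refinesD(1)[OF r] and s = refinesD(5)[OF r]
  note ss = projector_idem[OF p]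
  have sx: "s \<cdot> x \<in> homs C X E" "s \<cdot> (s \<cdot> x) = s \<cdot> x" if "X \<in> Obj C" "x \<in> homs C X E" for X x
    using comp_closed[OF that(1) E E that(2) s] Comp_assoc[OF that(1) E E E that(2) s s] ss by auto
  obtain \<beta> where nt: "nat_trans R C M (hom_functor C E) \<beta>"
    and bij: "\<And>X. X \<in> Obj C \<Longrightarrow> bij_betw (\<beta> X) (val X) {x \<in> homs C X E. s \<cdot> (s \<cdot> x) = x}"
    using projector_iso[OF p E s s ss ss] by blast
  have "{x \<in> homs C X E. s \<cdot> (s \<cdot> x) = x} = ?S X" if X: "X \<in> Obj C" for X
    using sx[OF X] Id_left[OF X E] by auto
  then have bij: "bij_betw (\<beta> X) (val X) (?S X)" if "X \<in> Obj C" for X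
    using bij[OF that] that by simp
  have "nat_trans R C M (restrict_functor (hom_functor C E) ?S) \<beta>"
    using nt bij_betwE[OF bij]
    unfolding nat_trans_def restrict_functor_def hom_functor_def mod_hom_def by simp
  then have "functor_iso R C M (restrict_functor (hom_functor C E) ?S)"
    unfolding functor_iso_def using bij by (auto simp: restrict_functor_def)
  moreover have "?S X \<inter> ?T X = {\<zero>\<^bsub>Hom C X E\<^esub>}" if X: "X \<in> Obj C" for X
    using Id_left[OF X E] comp_zero_left[OF X E E] zero_closed[OF X E] comp_zero_right[OF X E E s]
    by auto
  moreover have "\<exists>a \<in> ?S X. \<exists>b \<in> ?T X. x = a \<oplus>\<^bsub>Hom C X E\<^esub> b"
    if X: "X \<in> Obj C" and x: "x \<in> homs C X E" for X x
  proof (intro bexI)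
    let ?b = "x \<ominus>\<^bsub>Hom C X E\<^esub> (s \<cdot> x)"
    interpret H: abelian_group "Hom C X E" by (rule hom_group[OF X E])
    note c = sx[OF X x]
    show "x = (s \<cdot> x) \<oplus>\<^bsub>Hom C X E\<^esub> ?b" using x c by (simp add: a_minus_def H.a_lcomm H.r_neg)
    have b: "?b \<in> homs C X E" by (rule diff_closed[OF X E x c(1)])
    have "s \<cdot> ?b = \<zero>\<^bsub>Hom C X E\<^esub>"
      using comp_diff_right[OF X E E x c(1) s] diff_eq_zero_iff[OF X E c(1) c(1)] c(2) by simp
    then show "?b \<in> ?T X" using b comp_zero_left[OF X E E b] by simp
    show "s \<cdot> x \<in> ?S X" using c Id_left[OF X E c(1)] by simp
  qed
  ultimately show ?thesis
    unfolding iso_to_direct_summand_def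
    using subfunctor_hom_equalizer[OF E s Id_closed[OF E]]
      subfunctor_hom_equalizer[OF E s zero_closed[OF E E]]
    by (intro exI[of _ ?S] exI[of _ ?T]) (simp add: hom_functor_def)
qed

lemma projector_representable:
  assumes p: "projector E e s" and k: "karoubian C"
  shows "representable R C M"
proof -
  have "refines E e E e s" using p unfolding projector_def by auto
  note E = refinesD(1)[OF this] and s = refinesD(5)[OF this]
  obtain Y r i where Y: "Y \<in> Obj C" and ri: "r \<in> homs C E Y" "i \<in> homs C Y E"
    "i \<cdot> r = s" "r \<cdot> i = Id C Y"
    using k E s projector_idem[OF p] unfolding karoubian_def by blast
  have rs: "r \<cdot> s = r"
    using Comp_assoc[OF E Y E Y ri(1,2,1)] ri(3,4) Id_left[OF E Y ri(1)] by simp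
  have "r \<cdot> (i \<cdot> y) = y" if "X \<in> Obj C" "y \<in> homs C X Y" for X y
    using Comp_assoc[OF that(1) Y E Y that(2) ri(2,1)] ri(4) Id_left[OF that(1) Y that(2)] by simp
  then have "{y \<in> homs C X Y. r \<cdot> (i \<cdot> y) = y} = homs C X Y" if "X \<in> Obj C" for X
    using that by auto
  then have "functor_iso R C M (hom_functor C Y)"
    unfolding functor_iso_def using projector_iso[OF p Y ri(1,2,3) rs] by (simp add: hom_functor_def)
  then show ?thesis unfolding representable_def using Y by blast
qed

lemma finitely_generated_on_covers:
  assumes "\<A> \<subseteq> Obj C" "finitely_generated_on R C \<A> M"
  shows "\<exists>E \<in> Obj C. \<exists>e \<in> val E. \<forall>A \<in> \<A>. covers E e A"
proof -
  obtain E \<alpha> where E: "E \<in> \<A>" and nt: "nat_trans R C (hom_functor C E) M \<alpha>"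
    and sur: "\<And>X. X \<in> \<A> \<Longrightarrow> \<alpha> X ` homs C X E = val X"
    using assms(2) unfolding finitely_generated_on_def by blast
  have EO: "E \<in> Obj C" using E assms(1) by blast
  have "\<alpha> E (Id C E) \<in> val E" using sur[OF E] Id_closed[OF EO] by blast
  moreover have "covers E (\<alpha> E (Id C E)) A" if A: "A \<in> \<A>" for A
    unfolding covers_def
  proof
    fix m assume "m \<in> val A"
    then have "m \<in> \<alpha> A ` homs C A E" by (simp only: sur[OF A])
    then obtain x where x: "m = \<alpha> A x" "x \<in> homs C A E" by (rule imageE)
    have "A \<in> Obj C" using A assms(1) by (rule rev_subsetD)
    then show "\<exists>x \<in> homs C A E. FMor M x (\<alpha> E (Id C E)) = m"
      using nat_trans_eq_eval[OF nt EO _ x(2)] x by auto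
  qed
  ultimately show ?thesis using EO by blast
qed

lemma finitely_generated_kernel:
  assumes sub: "\<A> \<subseteq> Obj C" and E: "E \<in> Obj C" "e \<in> val E"
    and fg: "finitely_generated_on R C \<A> (kernel_functor (hom_functor C E) M (\<lambda>X x. FMor M x e))"
  shows "\<exists>A \<in> \<A>. \<exists>u \<in> homs C A E. FMor M u e = \<zero>\<^bsub>FObj M A\<^esub> \<and>
    (\<forall>X \<in> \<A>. \<forall>x \<in> homs C X E. FMor M x e = \<zero>\<^bsub>FObj M X\<^esub> \<longrightarrow> (\<exists>y \<in> homs C X A. x = u \<cdot> y))"
proof -
  let ?K = "kernel_functor (hom_functor C E) M (\<lambda>X x. FMor M x e)"
  have K: "carrier (FObj ?K X) = {x \<in> homs C X E. FMor M x e = \<zero>\<^bsub>FObj M X\<^esub>}" for X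
    unfolding kernel_functor_def restrict_functor_def hom_functor_def by simp
  obtain A \<alpha> where A: "A \<in> \<A>" and nt: "nat_trans R C (hom_functor C A) ?K \<alpha>"
    and sur: "\<And>X. X \<in> \<A> \<Longrightarrow> \<alpha> X ` homs C X A = carrier (FObj ?K X)"
    using fg unfolding finitely_generated_on_def by blast
  have AO: "A \<in> Obj C" using A sub by (rule rev_subsetD)
  let ?u = "\<alpha> A (Id C A)"
  have "?u \<in> \<alpha> A ` homs C A A" using Id_closed[OF AO] by (rule imageI)
  then have u: "?u \<in> homs C A E" "FMor M ?u e = \<zero>\<^bsub>FObj M A\<^esub>" unfolding sur[OF A] K by auto
  have \<alpha>: "\<alpha> X y = ?u \<cdot> y" if X: "X \<in> Obj C" and y: "y \<in> homs C X A" for X y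
  proof -
    have "\<alpha> X (Id C A \<cdot> y) = ?u \<cdot> y"
      using nt X AO y Id_closed[OF AO]
      unfolding nat_trans_def kernel_functor_def restrict_functor_def hom_functor_def by simp
    then show ?thesis using Id_left[OF X AO y] by simp
  qed
  have "\<exists>y \<in> homs C X A. x = ?u \<cdot> y"
    if X: "X \<in> \<A>" and x: "x \<in> homs C X E" "FMor M x e = \<zero>\<^bsub>FObj M X\<^esub>" for X x
  proof -
    have "x \<in> \<alpha> X ` homs C X A" unfolding sur[OF X] K using x by simp
    then obtain y where y: "x = \<alpha> X y" "y \<in> homs C X A" by (rule imageE)
    have "X \<in> Obj C" using X sub by (rule rev_subsetD)
    then show ?thesis using \<alpha> y by blast
  qed
  then show ?thesis using A u by blast
qed

end

section \<open>Representability\<close>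

theorem theorem2p2:
  fixes R :: "('r, 'k) ring_scheme"
    and D :: "('r, 'o, 'm, 'c) tri_cat_scheme"
    and M :: "('r, 'o, 'm, 'v) cfunctor"
    and \<A> :: "'o set"
  assumes "triangulated_category R D"
    and "cohomological R D M"
    and "\<A> \<subseteq> Obj D"
    and "Sh D ` \<A> = \<A>"
    and "precovering D \<A>"
    and "\<exists>n\<ge>1. ext_pow D \<A> n = Obj D"
    and "finitely_generated_on R D \<A> M"
    and "\<And>X \<alpha>. \<lbrakk>X \<in> Obj D; nat_trans R D (hom_functor D X) M \<alpha>\<rbrakk>
           \<Longrightarrow> finitely_generated_on R D \<A> (kernel_functor (hom_functor D X) M \<alpha>)"
  shows "(\<exists>X \<in> Obj D. iso_to_direct_summand R D M (hom_functor D X)) \<and>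
    (karoubian D \<longrightarrow> representable R D M)"
proof -
  interpret triangulated_category R D by fact
  interpret linear_functor R D M
    using assms(2) by unfold_locales (simp add: cohomological_def)
  interpret cohomological_functor R D M
    using assms(2) unfolding cohomological_def by unfold_locales blast
  have "controlled \<A> \<A>"
    by (rule controlled_base[OF assms(3) finitely_generated_kernel[OF assms(3)]])
      (auto intro: assms(8) eval_nat_trans)
  moreover obtain n where "ext_pow D \<A> (Suc n) = Obj D"
    using assms(6) by (metis One_nat_def Suc_le_D)
  ultimately have c: "controlled \<A> (Obj D)"
    using controlled_ext_pow[OF assms(3,4), of n] by simp
  obtain E e s where p: "projector E e s"
    using finitely_generated_on_covers[OF assms(3,7)] ex_projector[OF c assms(3)] by blast
  have "E \<in> Obj D" using p unfolding projector_def refines_def by simp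
  then show ?thesis using projector_direct_summand[OF p] projector_representable[OF p] by blast
qed

end
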